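(* Let $k=1$, $n=2$, and let $\psi(r)=1$ if $0\le r\le 1$ and $\psi(r)=0$ if $r>1$. Then the Abel type integral equation $$c\, r^{2-n}\int_0^r s^{n-k-1}\,w(s)\,(r^2-s^2)^{k/2-1}\,ds=\psi(r),\quad r>0,\qquad c=\frac{\sigma_{k-1}\,\sigma_{n-k-1}}{\sigma_{n-1}},$$ that is, $\frac{2}{\pi}\int_0^r w(s)(r^2-s^2)^{-1/2}\,ds=\psi(r)$, has a solution $$w(r)=\begin{cases}1 & \text{if } 0\le r\le 1,\\[4pt] \displaystyle 1-\frac{r}{\sqrt{r^2-1}} & \text{if } r>1,\end{cases}$$ such that for every compactly supported continuous function $f$ on $\mathbb{R}^2$, $$(W_a^*\hat f)(x)=\int_{|y|<1}f(x-ay)\,dy,\qquad a>0,\ x\in\mathbb{R}^2,$$ where $W_a^*$ is the wavelet-like transform generated by $w$.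
   Context: Notation. $\sigma_{m-1}=2\pi^{m/2}/\Gamma(m/2)$ is the area of the unit sphere $S^{m-1}$ in $\mathbb{R}^m$ (so $\sigma_0=2$, $\sigma_1=2\pi$). $G_{2,1}$ is the manifold of lines $\zeta$ through the origin in $\mathbb{R}^2$ and $\mathcal{G}_{2,1}$ is the manifold of all non-oriented affine lines $\tau$ in $\mathbb{R}^2$. Each $\tau\in\mathcal{G}_{2,1}$ is parameterized by a pair $(\zeta,x'')$ with $\zeta\in G_{2,1}$, $x''\in\zeta^\perp$ (so $\tau=\zeta+x''$). $\mathcal{G}_{2,1}$ is endowed with the measure $d\tau=d\zeta\,dx''$, where $d\zeta$ is the rotation-invariant probability measure on $G_{2,1}$ and $dx''$ is Lebesgue measure on $\zeta^\perp$. The Radon transform over lines of a function $f$ on $\mathbb{R}^2$ is $$\hat f(\tau)=\int_\zeta f(x'+x'')\,dx',\qquad \tau=(\zeta,x'')\in\mathcal{G}_{2,1}.$$ The wavelet-like transform generated by $w$ is $$(W_a^*\varphi)(x)=\frac{1}{a^2}\int_{\mathcal{G}_{2,1}}\varphi(\tau)\,w\!\left(\frac{|x-\tau|}{a}\right)d\tau,\qquad a>0,\ x\in\mathbb{R}^2,$$ where $|x-\tau|$ is the Euclidean distance from the point $x$ to the line $\tau$. *)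

theory Defs
  imports "HOL-Probability.Probability"
begin

text \<open>\<open>sphere_area j\<close> is the area of the unit sphere \<open>S^j\<close> in the space of dimension \<open>j + 1\<close>.\<close>

definition sphere_area :: "nat \<Rightarrow> real"
  where "sphere_area j = 2 * pi powr (real (j + 1) / 2) / Gamma (real (j + 1) / 2)"

definition abel_integrand :: "nat \<Rightarrow> nat \<Rightarrow> (real \<Rightarrow> real) \<Rightarrow> real \<Rightarrow> real \<Rightarrow> real"
  where "abel_integrand k n w r s =
    s ^ (n - k - 1) * w s * (r\<^sup>2 - s\<^sup>2) powr (real k / 2 - 1)"

definition solves_abel_equation :: "nat \<Rightarrow> nat \<Rightarrow> (real \<Rightarrow> real) \<Rightarrow> (real \<Rightarrow> real) \<Rightarrow> bool"
  where "solves_abel_equation k n w \<psi> \<longleftrightarrow>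
    (\<forall>r>0. set_integrable lborel {0<..<r} (abel_integrand k n w r) \<and>
       sphere_area (k - 1) * sphere_area (n - k - 1) / sphere_area (n - 1) *
         r powr (2 - real n) * (LINT s:{0<..<r}|lborel. abel_integrand k n w r s) = \<psi> r)"

definition G21 :: "(real^2) set set"
  where "G21 = {\<zeta>. subspace \<zeta> \<and> dim \<zeta> = 1}"

text \<open>The Borel sigma-algebra of \<open>G21\<close>, seen as the quotient of the unit circle under
  \<open>v \<mapsto> span {v}\<close>; see \<open>sets_G21_sigma\<close>.\<close>

definition G21_sigma :: "(real^2) set measure"
  where "G21_sigma = sigma G21 {A. A \<subseteq> G21 \<and> {v \<in> sphere 0 1. span {v} \<in> A} \<in> sets borel}"

definition dir :: "real \<Rightarrow> real^2"
  where "dir \<theta> = vector [cos \<theta>, sin \<theta>]"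

definition nrm :: "real \<Rightarrow> real^2"
  where "nrm \<theta> = vector [- sin \<theta>, cos \<theta>]"

text \<open>The probability measure on \<open>G21\<close> induced by a uniformly distributed angle. It is the only
  rotation-invariant one: \<open>prob_space_G21_measure\<close>, \<open>G21_measure_rotation_invariant\<close> and
  \<open>G21_measure_unique\<close>.\<close>

definition G21_measure :: "(real^2) set measure"
  where "G21_measure =
    distr (uniform_measure lborel {0..2*pi}) G21_sigma (\<lambda>\<theta>. span {dir \<theta>})"

text \<open>One-dimensional Lebesgue measure on a line \<open>\<zeta>\<close> through the origin; the choice between the
  two unit vectors of \<open>\<zeta>\<close> is immaterial (\<open>line_lebesgue_span\<close>).\<close>

definition line_lebesgue :: "(real^2) set \<Rightarrow> (real^2) measure"
  where "line_lebesgue \<zeta> =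
    distr lborel (restrict_space borel \<zeta>) (\<lambda>t. t *\<^sub>R (SOME u. u \<in> \<zeta> \<and> norm u = 1))"

text \<open>An affine line is represented by the pair \<open>(\<zeta>, x'')\<close> of its direction and its point in the
  orthogonal complement of \<open>\<zeta>\<close>; \<open>line_of\<close> recovers the point set, bijectively
  (\<open>bij_betw_line_of\<close>).\<close>

definition A21 :: "((real^2) set \<times> (real^2)) set"
  where "A21 = Sigma G21 orthogonal_comp"

definition line_of :: "(real^2) set \<times> (real^2) \<Rightarrow> (real^2) set"
  where "line_of \<tau> = (\<lambda>x'. x' + snd \<tau>) ` fst \<tau>"

definition A21_sigma :: "((real^2) set \<times> (real^2)) measure"
  where "A21_sigma = restrict_space (G21_sigma \<Otimes>\<^sub>M borel) A21"

text \<open>The set function below is countably additive, so that it is indeed the \<open>emeasure\<close> of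
  \<open>A21_measure\<close>: \<open>emeasure_A21_measure\<close>.\<close>

definition A21_measure :: "((real^2) set \<times> (real^2)) measure"
  where "A21_measure = measure_of A21 (sets A21_sigma)
    (\<lambda>A. \<integral>\<^sup>+\<zeta>. emeasure (line_lebesgue (\<zeta>\<^sup>\<bottom>)) (Pair \<zeta> -` A) \<partial>G21_measure)"

definition radon ::
    "(real^2 \<Rightarrow> 'b::{banach,second_countable_topology}) \<Rightarrow> (real^2) set \<times> (real^2) \<Rightarrow> 'b"
  where "radon f \<tau> = (\<integral>x'. f (x' + snd \<tau>) \<partial>line_lebesgue (fst \<tau>))"

definition wavelet_integrand ::
    "(real \<Rightarrow> real) \<Rightarrow> real \<Rightarrow> ((real^2) set \<times> (real^2) \<Rightarrow> 'b::{banach,second_countable_topology}) \<Rightarrow>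
      real^2 \<Rightarrow> (real^2) set \<times> (real^2) \<Rightarrow> 'b"
  where "wavelet_integrand w a \<phi> x \<tau> = w (infdist x (line_of \<tau>) / a) *\<^sub>R \<phi> \<tau>"

definition wavelet_transform ::
    "(real \<Rightarrow> real) \<Rightarrow> real \<Rightarrow> ((real^2) set \<times> (real^2) \<Rightarrow> 'b::{banach,second_countable_topology}) \<Rightarrow>
      real^2 \<Rightarrow> 'b"
  where "wavelet_transform w a \<phi> x = (1 / a\<^sup>2) *\<^sub>R (\<integral>\<tau>. wavelet_integrand w a \<phi> x \<tau> \<partial>A21_measure)"

lemma sphere_dir: "v \<in> sphere (0::real^2) 1 \<longleftrightarrow> (\<exists>\<theta>. v = dir \<theta>)"
proof
  assume "v \<in> sphere (0::real^2) 1"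
  hence "(v$1)^2 + (v$2)^2 = 1"
    by (simp add: norm_vec_def L2_set_def UNIV_2)
  then obtain t where "v$1 = cos t" "v$2 = sin t"
    using sincos_total_2pi by metis
  thus "\<exists>\<theta>. v = dir \<theta>"
    by (auto simp: dir_def vec_eq_iff forall_2 intro!: exI[of _ t])
qed (auto simp: dir_def norm_vec_def L2_set_def UNIV_2)

lemma norm_dir [simp]: "norm (dir \<theta>) = 1" and norm_nrm [simp]: "norm (nrm \<theta>) = 1"
  by (auto simp: dir_def nrm_def norm_vec_def L2_set_def UNIV_2)

lemma span_in_G21: "norm v = 1 \<Longrightarrow> span {v} \<in> G21"
  by (auto simp: G21_def subspace_span dim_span dim_singleton)

lemma G21_spanE:
  assumes "\<zeta> \<in> G21" "u \<in> \<zeta>" "norm u = 1"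
  shows "\<zeta> = span {u}"
proof -
  have "span {u} \<subseteq> \<zeta>" using assms span_minimal[of "{u}" \<zeta>] by (auto simp: G21_def)
  moreover have "dim \<zeta> \<le> dim (span {u})" using assms span_in_G21[of u] by (simp add: G21_def)
  ultimately show ?thesis
    using assms subspace_dim_equal[of "span {u}" \<zeta>] by (auto simp: G21_def)
qed

lemma G21_ex_unit:
  assumes "\<zeta> \<in> G21" shows "\<exists>u. u \<in> \<zeta> \<and> norm u = 1"
proof -
  have "\<not> \<zeta> \<subseteq> {0}" using assms dim_eq_0[of \<zeta>] by (auto simp: G21_def)
  then obtain v where v: "v \<in> \<zeta>" "v \<noteq> 0" by auto
  with assms show ?thesis
    by (intro exI[of _ "v /\<^sub>R norm v"]) (auto simp: G21_def subspace_scale)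
qed

lemma G21_iff_dir: "\<zeta> \<in> G21 \<longleftrightarrow> (\<exists>\<theta>. \<zeta> = span {dir \<theta>})"
proof
  assume "\<zeta> \<in> G21"
  then obtain u where "u \<in> \<zeta>" "norm u = 1" using G21_ex_unit by blast
  thus "\<exists>\<theta>. \<zeta> = span {dir \<theta>}"
    using G21_spanE[OF \<open>\<zeta> \<in> G21\<close>] sphere_dir[of u] by auto
qed (auto intro: span_in_G21)

lemma orthogonal_comp_dir: "(span {dir \<theta>})\<^sup>\<bottom> = span {nrm \<theta>}"
proof -
  have "x \<in> span {nrm \<theta>} \<longleftrightarrow> dir \<theta> \<bullet> x = 0" for x
  proof
    assume "dir \<theta> \<bullet> x = 0"
    hence *: "cos \<theta> * x$1 + sin \<theta> * x$2 = 0" by (simp add: dir_def inner_vec_def UNIV_2)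
    have cs: "cos \<theta> ^2 = 1 - sin \<theta> ^2" using sin_cos_squared_add[of \<theta>] by linarith
    have "x = (cos \<theta> * x$2 - sin \<theta> * x$1) *\<^sub>R nrm \<theta>"
      using * cs by (simp add: nrm_def vec_eq_iff forall_2) algebra
    thus "x \<in> span {nrm \<theta>}" by (metis insertI1 span_base span_scale)
  next
    assume "x \<in> span {nrm \<theta>}"
    then obtain k where "x = k *\<^sub>R nrm \<theta>" by (auto simp: span_singleton)
    thus "dir \<theta> \<bullet> x = 0" by (simp add: dir_def nrm_def inner_vec_def UNIV_2)
  qed
  moreover have "x \<in> (span {dir \<theta>})\<^sup>\<bottom> \<longleftrightarrow> dir \<theta> \<bullet> x = 0" for x
    by (auto simp: orthogonal_comp_def orthogonal_def span_singleton span_base)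
  ultimately show ?thesis by blast
qed

lemma line_lebesgue_span:
  assumes "norm u = 1"
  shows "line_lebesgue (span {u}) = distr lborel (restrict_space borel (span {u})) (\<lambda>t. t *\<^sub>R u)"
proof -
  define v where "v = (SOME v. v \<in> span {u} \<and> norm v = 1)"
  have v: "v \<in> span {u}" "norm v = 1"
    using someI[of "\<lambda>v. v \<in> span {u} \<and> norm v = 1" u] assms span_base[of u "{u}"]
    by (auto simp: v_def)
  then obtain k where k: "v = k *\<^sub>R u" by (auto simp: span_singleton)
  have "\<bar>k\<bar> = 1" using v(2) k assms by simp
  hence "k = 1 \<or> k = -1" by linarith
  hence "v = u \<or> v = - u" using k by auto
  moreover have m: "(\<lambda>t. t *\<^sub>R u) \<in> borel \<rightarrow>\<^sub>M restrict_space borel (span {u})"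
    by (intro measurable_restrict_space2) (auto intro: span_scale span_base)
  have "distr lborel (restrict_space borel (span {u})) (\<lambda>t. t *\<^sub>R (- u))
      = distr (distr lborel borel uminus) (restrict_space borel (span {u})) (\<lambda>t. t *\<^sub>R u)"
    by (subst distr_distr) (use m in \<open>auto simp: o_def\<close>)
  ultimately show ?thesis
    unfolding line_lebesgue_def v_def[symmetric] by (auto simp: lborel_distr_uminus)
qed

lemma space_G21_sigma [simp]: "space G21_sigma = G21"
  unfolding G21_sigma_def by (rule space_measure_of) auto

lemma sets_G21_sigma:
  "sets G21_sigma = {A. A \<subseteq> G21 \<and> {v \<in> sphere 0 1. span {v} \<in> A} \<in> sets borel}" (is "_ = ?S")
proof -
  have "sigma_algebra G21 ?S"
  proof (subst sigma_algebra_iff2, intro conjI ballI allI impI)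
    show "?S \<subseteq> Pow G21" by auto
    show "{} \<in> ?S" by auto
  next
    fix A assume A: "A \<in> ?S"
    have "{v \<in> sphere 0 1. span {v} \<in> G21 - A} = sphere 0 1 - {v \<in> sphere 0 1. span {v} \<in> A}"
      by (auto intro: span_in_G21)
    thus "G21 - A \<in> ?S" using A by auto
  next
    fix A :: "nat \<Rightarrow> _" assume A: "range A \<subseteq> ?S"
    have "{v \<in> sphere 0 1. span {v} \<in> \<Union> (range A)} = (\<Union>i. {v \<in> sphere 0 1. span {v} \<in> A i})"
      by auto
    moreover have "\<dots> \<in> sets borel" using A by (intro sets.countable_UN) auto
    ultimately show "\<Union> (range A) \<in> ?S" using A by auto
  qed
  thus ?thesis
    unfolding G21_sigma_def by (rule sigma_algebra.sets_measure_of_eq)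
qed

lemma measurable_G21_sigma:
  "f \<in> G21_sigma \<rightarrow>\<^sub>M M \<longleftrightarrow> (\<lambda>v. f (span {v})) \<in> restrict_space borel (sphere 0 1) \<rightarrow>\<^sub>M M"
proof -
  have "f -` A \<inter> G21 \<in> sets G21_sigma \<longleftrightarrow>
     (\<lambda>v. f (span {v})) -` A \<inter> sphere 0 1 \<in> sets (restrict_space borel (sphere 0 1))" for A
  proof -
    have "{v \<in> sphere 0 1. span {v} \<in> f -` A \<inter> G21} = (\<lambda>v. f (span {v})) -` A \<inter> sphere 0 1"
      by (auto intro: span_in_G21)
    thus ?thesis by (simp add: sets_G21_sigma sets_restrict_space_iff)
  qed
  moreover have "f \<in> G21 \<rightarrow> space M \<longleftrightarrow> (\<lambda>v. f (span {v})) \<in> sphere 0 1 \<rightarrow> space M"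
    unfolding Pi_iff Ball_def G21_iff_dir sphere_dir by metis
  ultimately show ?thesis
    by (simp add: measurable_def space_restrict_space)
qed

lemma borel_measurable_vector2 [measurable]:
  assumes [measurable]: "f \<in> borel_measurable M" "g \<in> borel_measurable M"
  shows "(\<lambda>x. vector [f x, g x] :: real^2) \<in> borel_measurable M"
proof (rule borel_measurable_euclidean_space[THEN iffD2], rule)
  fix b :: "real^2" assume "b \<in> Basis"
  have "(\<lambda>x. (vector [f x, g x] :: real^2) \<bullet> b) = (\<lambda>x. f x * b$1 + g x * b$2)"
    by (auto simp: inner_vec_def UNIV_2)
  thus "(\<lambda>x. (vector [f x, g x] :: real^2) \<bullet> b) \<in> borel_measurable M" by simp
qed

lemma borel_measurable_dir [measurable]: "dir \<in> borel_measurable borel"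
  and borel_measurable_nrm [measurable]: "nrm \<in> borel_measurable borel"
  unfolding dir_def nrm_def by measurable

lemma measurable_span_sphere:
  "(\<lambda>v. span {v}) \<in> restrict_space borel (sphere 0 1) \<rightarrow>\<^sub>M G21_sigma"
  using measurable_G21_sigma[of "\<lambda>x. x" G21_sigma] by simp

lemma measurable_span_dir [measurable]: "(\<lambda>\<theta>. span {dir \<theta>}) \<in> borel \<rightarrow>\<^sub>M G21_sigma"
  by (rule measurable_compose[OF _ measurable_span_sphere], rule measurable_restrict_space2) auto


lemma space_A21_sigma [simp]: "space A21_sigma = A21"
  by (auto simp: A21_sigma_def A21_def space_restrict_space space_pair_measure)

lemma span_nrm_in_A21: "(span {dir \<theta>}, t *\<^sub>R nrm \<theta>) \<in> A21"
  by (auto simp: A21_def orthogonal_comp_dir span_in_G21 intro: span_scale span_base)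

lemma measurable_A21_param [measurable]:
  "(\<lambda>(\<theta>, t). (span {dir \<theta>}, t *\<^sub>R nrm \<theta>)) \<in> (borel \<Otimes>\<^sub>M borel) \<rightarrow>\<^sub>M A21_sigma"
  unfolding A21_sigma_def
  by (rule measurable_restrict_space2) (auto simp: span_nrm_in_A21)

lemma emeasure_section:
  assumes "A \<in> sets A21_sigma"
  shows "emeasure (line_lebesgue ((span {dir \<theta>})\<^sup>\<bottom>)) (Pair (span {dir \<theta>}) -` A)
       = (\<integral>\<^sup>+t. indicator A (span {dir \<theta>}, t *\<^sub>R nrm \<theta>) \<partial>lborel)"
proof -
  let ?\<zeta> = "span {dir \<theta>}" and ?\<eta> = "span {nrm \<theta>}"
  from assms obtain B where B: "B \<in> sets (G21_sigma \<Otimes>\<^sub>M borel)" "A = A21 \<inter> B"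
    by (auto simp: A21_sigma_def sets_restrict_space)
  have "Pair ?\<zeta> -` A = ?\<eta> \<inter> Pair ?\<zeta> -` B"
    using B by (auto simp: A21_def orthogonal_comp_dir span_in_G21)
  hence A: "Pair ?\<zeta> -` A \<in> sets (restrict_space borel ?\<eta>)"
    using sets_Pair1[OF B(1)] by (auto simp: sets_restrict_space)
  have m: "(\<lambda>t. t *\<^sub>R nrm \<theta>) \<in> borel \<rightarrow>\<^sub>M restrict_space borel ?\<eta>"
    by (intro measurable_restrict_space2) (auto intro: span_scale span_base)
  have "emeasure (line_lebesgue (?\<zeta>\<^sup>\<bottom>)) (Pair ?\<zeta> -` A)
      = emeasure lborel ((\<lambda>t. t *\<^sub>R nrm \<theta>) -` (Pair ?\<zeta> -` A))"
    by (simp add: orthogonal_comp_dir line_lebesgue_span emeasure_distr[OF _ A] m)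
  also have "\<dots> = (\<integral>\<^sup>+t. indicator ((\<lambda>t. t *\<^sub>R nrm \<theta>) -` (Pair ?\<zeta> -` A)) t \<partial>lborel)"
    using measurable_sets[OF m A] by (intro nn_integral_indicator[symmetric]) simp
  also have "\<dots> = (\<integral>\<^sup>+t. indicator A (?\<zeta>, t *\<^sub>R nrm \<theta>) \<partial>lborel)"
    by (intro nn_integral_cong) (auto simp: indicator_def)
  finally show ?thesis .
qed

lemma measurable_section:
  assumes A: "A \<in> sets A21_sigma"
  shows "(\<lambda>\<zeta>. emeasure (line_lebesgue (\<zeta>\<^sup>\<bottom>)) (Pair \<zeta> -` A)) \<in> borel_measurable G21_sigma"
proof -
  let ?J = "\<lambda>v::real^2. vector [- (v$2), v$1] :: real^2"
  let ?S = "restrict_space borel (sphere (0::real^2) 1)"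
  from A obtain B where B: "B \<in> sets (G21_sigma \<Otimes>\<^sub>M borel)" "A = A21 \<inter> B"
    by (auto simp: A21_sigma_def sets_restrict_space)
  have J: "?J (dir \<theta>) = nrm \<theta>" for \<theta> by (simp add: dir_def nrm_def)
  have id: "(\<lambda>v. v) \<in> ?S \<rightarrow>\<^sub>M borel" by (rule measurable_restrict_space1) simp
  have nth: "(\<lambda>v. v $ i) \<in> ?S \<rightarrow>\<^sub>M borel" for i
    by (intro measurable_restrict_space1 borel_measurable_continuous_onI continuous_intros)
  have Jm: "?J \<in> ?S \<rightarrow>\<^sub>M borel" using nth by measurable
  note [measurable] = B(1) Jm measurable_span_sphere
  have "(\<lambda>p. (span {fst p}, snd p *\<^sub>R ?J (fst p))) \<in> (?S \<Otimes>\<^sub>M lborel) \<rightarrow>\<^sub>M (G21_sigma \<Otimes>\<^sub>M borel)"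
  proof (rule measurable_Pair)
    show "(\<lambda>p. span {fst p}) \<in> ?S \<Otimes>\<^sub>M lborel \<rightarrow>\<^sub>M G21_sigma"
      by (rule measurable_compose[OF measurable_fst measurable_span_sphere])
    show "(\<lambda>p. snd p *\<^sub>R ?J (fst p)) \<in> ?S \<Otimes>\<^sub>M lborel \<rightarrow>\<^sub>M borel"
      using measurable_compose[OF measurable_fst Jm] by (intro borel_measurable_scaleR) auto
  qed
  from measurable_compose[OF this borel_measurable_indicator[OF B(1)]]
  have "(\<lambda>v. \<integral>\<^sup>+t. indicator B (span {v}, t *\<^sub>R ?J v) \<partial>lborel :: ennreal) \<in> borel_measurable ?S"
    by (intro lborel.borel_measurable_nn_integral) (simp add: case_prod_beta')
  moreover have "emeasure (line_lebesgue ((span {v})\<^sup>\<bottom>)) (Pair (span {v}) -` A)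
      = (\<integral>\<^sup>+t. indicator B (span {v}, t *\<^sub>R ?J v) \<partial>lborel)" if v: "v \<in> space ?S" for v
  proof -
    from v obtain \<theta> where "v = dir \<theta>" using sphere_dir[of v] by (auto simp: space_restrict_space)
    thus ?thesis using emeasure_section[OF A, of \<theta>] B(2) span_nrm_in_A21
      by (auto simp: J indicator_def)
  qed
  ultimately show ?thesis
    unfolding measurable_G21_sigma by (subst measurable_cong) auto
qed

abbreviation angle_measure :: "real measure"
  where "angle_measure \<equiv> uniform_measure lborel {0..2*pi}"

lemma prob_space_angle: "prob_space angle_measure"
  by (rule prob_space_uniform_measure) auto

lemma prob_space_G21_measure: "prob_space G21_measure"
  unfolding G21_measure_def by (rule prob_space.prob_space_distr[OF prob_space_angle]) simp

lemma nn_integral_section: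
  assumes A: "A \<in> sets A21_sigma"
  shows "(\<integral>\<^sup>+\<zeta>. emeasure (line_lebesgue (\<zeta>\<^sup>\<bottom>)) (Pair \<zeta> -` A) \<partial>G21_measure) =
    emeasure (distr (angle_measure \<Otimes>\<^sub>M lborel) A21_sigma
      (\<lambda>(\<theta>, t). (span {dir \<theta>}, t *\<^sub>R nrm \<theta>))) A"
    (is "_ = emeasure (distr _ _ ?T) A")
proof -
  have T: "?T \<in> angle_measure \<Otimes>\<^sub>M lborel \<rightarrow>\<^sub>M A21_sigma"
    using measurable_A21_param
    by (simp cong: measurable_cong_sets add: sets_pair_measure_cong[of angle_measure borel lborel borel])
  have "(\<integral>\<^sup>+\<zeta>. emeasure (line_lebesgue (\<zeta>\<^sup>\<bottom>)) (Pair \<zeta> -` A) \<partial>G21_measure)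
     = (\<integral>\<^sup>+\<theta>. (\<integral>\<^sup>+t. indicator A (?T (\<theta>, t)) \<partial>lborel) \<partial>angle_measure)"
    unfolding G21_measure_def
    by (subst nn_integral_distr) (use measurable_section[OF A] emeasure_section[OF A] in auto)
  also have "\<dots> = (\<integral>\<^sup>+p. indicator A (?T p) \<partial>(angle_measure \<Otimes>\<^sub>M lborel))"
    by (rule lborel.nn_integral_fst) (rule measurable_compose[OF T borel_measurable_indicator[OF A]])
  also have "\<dots> = emeasure (distr (angle_measure \<Otimes>\<^sub>M lborel) A21_sigma ?T) A"
    using A by (subst nn_integral_distr[OF T, symmetric]) auto
  finally show ?thesis .
qed

lemma A21_measure_param:
  "A21_measure = distr (angle_measure \<Otimes>\<^sub>M lborel) A21_sigma (\<lambda>(\<theta>, t). (span {dir \<theta>}, t *\<^sub>R nrm \<theta>))"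
  (is "_ = ?D")
proof -
  have "A21_measure = measure_of A21 (sets A21_sigma) (emeasure ?D)"
    unfolding A21_measure_def
    using sets.sigma_sets_eq[of A21_sigma] sets.space_closed[of A21_sigma]
    by (intro measure_of_eq) (auto simp: nn_integral_section)
  also have "\<dots> = ?D" using measure_of_of_measure[of ?D] by simp
  finally show ?thesis .
qed

lemma sets_A21_measure [simp]: "sets A21_measure = sets A21_sigma"
  by (simp add: A21_measure_param)

lemma space_A21_measure [simp]: "space A21_measure = A21"
  using sets_eq_imp_space_eq[OF sets_A21_measure] by simp

lemma emeasure_A21_measure:
  "A \<in> sets A21_sigma \<Longrightarrow> emeasure A21_measure A =
    (\<integral>\<^sup>+\<zeta>. emeasure (line_lebesgue (\<zeta>\<^sup>\<bottom>)) (Pair \<zeta> -` A) \<partial>G21_measure)"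
  by (simp add: nn_integral_section A21_measure_param)

lemma bij_betw_line_of: "bij_betw line_of A21 {\<tau>. affine \<tau> \<and> aff_dim \<tau> = 1}"
proof (rule bij_betw_imageI)
  show "inj_on line_of A21"
  proof (rule inj_onI, clarify)
    fix \<zeta> x \<eta> y
    assume A: "(\<zeta>, x) \<in> A21" "(\<eta>, y) \<in> A21" and eq: "line_of (\<zeta>, x) = line_of (\<eta>, y)"
    have dirs: "\<zeta> = {p - q |p q. p \<in> line_of (\<zeta>, x) \<and> q \<in> line_of (\<zeta>, x)}"
      if "(\<zeta>, x) \<in> A21" for \<zeta> x
    proof -
      have s: "subspace \<zeta>" using that by (auto simp: A21_def G21_def)
      have "z \<in> {p - q |p q. p \<in> line_of (\<zeta>, x) \<and> q \<in> line_of (\<zeta>, x)}" if "z \<in> \<zeta>" for z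
      proof -
        have "z + x \<in> line_of (\<zeta>, x)" "0 + x \<in> line_of (\<zeta>, x)"
          using that subspace_0[OF s] unfolding line_of_def by auto
        moreover have "z = (z + x) - (0 + x)" by simp
        ultimately show ?thesis by blast
      qed
      thus ?thesis using s by (auto simp: line_of_def subspace_diff)
    qed
    have "\<zeta> = \<eta>" using dirs[OF A(1)] dirs[OF A(2)] eq by simp
    moreover have s: "subspace \<zeta>" using A by (auto simp: A21_def G21_def)
    have "x \<in> line_of (\<eta>, y)"
      using subspace_0[OF s] eq by (force simp: line_of_def)
    hence "x - y \<in> \<eta>" by (auto simp: line_of_def)
    moreover have "x - y \<in> \<eta>\<^sup>\<bottom>"
      using A \<open>\<zeta> = \<eta>\<close> by (auto simp: A21_def intro: subspace_diff subspace_orthogonal_comp)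
    ultimately show "\<zeta> = \<eta> \<and> x = y"
      by (auto simp: orthogonal_comp_def orthogonal_self)
  qed
next
  show "line_of ` A21 = {\<tau>. affine \<tau> \<and> aff_dim \<tau> = 1}"
  proof (intro equalityI subsetI; clarify)
    fix \<zeta> x assume "(\<zeta>, x) \<in> A21"
    hence *: "subspace \<zeta>" "dim \<zeta> = 1" by (auto simp: A21_def G21_def)
    have eq: "line_of (\<zeta>, x) = (+) x ` \<zeta>" by (auto simp: line_of_def add.commute)
    show "affine (line_of (\<zeta>, x)) \<and> aff_dim (line_of (\<zeta>, x)) = 1"
      unfolding eq using * affine_translation[of \<zeta> x]
      by (simp add: aff_dim_translation_eq aff_dim_subspace subspace_imp_affine)
  next
    fix \<tau> :: "(real^2) set" assume \<tau>: "affine \<tau>" "aff_dim \<tau> = 1"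
    then obtain a where a: "a \<in> \<tau>" by fastforce
    define \<zeta> where "\<zeta> = (+) (- a) ` \<tau>"
    have sub: "subspace \<zeta>"
      using affine_diffs_subspace[OF \<tau>(1) a] by (simp add: \<zeta>_def)
    have "aff_dim \<zeta> = 1" unfolding \<zeta>_def aff_dim_translation_eq by (rule \<tau>(2))
    hence "int (dim \<zeta>) = 1" using aff_dim_subspace[OF sub] by simp
    hence dim: "dim \<zeta> = 1" by simp
    obtain y z where yz: "y \<in> \<zeta>" "\<And>w. w \<in> \<zeta> \<Longrightarrow> orthogonal z w" "a = y + z"
      using orthogonal_subspace_decomp_exists[of \<zeta> a] sub by (metis span_eq_iff)
    have "(\<zeta>, z) \<in> A21"
      using sub dim yz(2) by (auto simp: A21_def G21_def orthogonal_comp_def orthogonal_commute)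
    moreover have "\<tau> = line_of (\<zeta>, z)"
    proof (intro set_eqI iffI)
      fix p assume "p \<in> \<tau>"
      hence "p - a + y \<in> \<zeta>" using sub yz(1) by (intro subspace_add) (auto simp: \<zeta>_def)
      thus "p \<in> line_of (\<zeta>, z)" using yz(3) by (auto simp: line_of_def intro!: image_eqI[of _ _ "p - a + y"])
    next
      fix p assume "p \<in> line_of (\<zeta>, z)"
      hence "p - z \<in> \<zeta>" by (auto simp: line_of_def)
      hence "p - z - y \<in> \<zeta>" by (rule subspace_diff[OF sub _ yz(1)])
      thus "p \<in> \<tau>" using yz(3) by (auto simp: \<zeta>_def algebra_simps)
    qed
    ultimately show "\<tau> \<in> line_of ` A21" by blast
  qed
qed

lemma emeasure_periodic_shift:
  fixes P :: "real set"
  assumes P [measurable]: "P \<in> sets borel" and per: "\<And>\<theta>. \<theta> + 2*pi \<in> P \<longleftrightarrow> \<theta> \<in> P"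
  shows "emeasure lborel ({0..2*pi} \<inter> {\<theta>. \<theta> + \<beta> \<in> P}) = emeasure lborel ({0..2*pi} \<inter> P)"
proof -
  have per': "\<theta> + of_int k * (2*pi) \<in> P \<longleftrightarrow> \<theta> \<in> P" for \<theta> k
  proof (induction k rule: int_induct[where k = 0])
    case (step1 i) thus ?case using per[of "\<theta> + of_int i * (2*pi)"] by (simp add: algebra_simps)
  next
    case (step2 i) thus ?case using per[of "\<theta> + of_int (i - 1) * (2*pi)"] by (simp add: algebra_simps)
  qed simp
  have shift: "emeasure lborel ({\<theta>. \<theta> + c \<in> X}) = emeasure lborel X" if [measurable]: "X \<in> sets borel" for c and X :: "real set"
  proof -
    have "emeasure lborel X = emeasure (distr lborel borel ((+) c)) X" by (simp add: lborel_distr_plus)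
    also have "\<dots> = emeasure lborel {\<theta>. \<theta> + c \<in> X}"
      by (subst emeasure_distr) (auto simp: vimage_def add.commute)
    finally show ?thesis ..
  qed
  have ae: "emeasure lborel ({0..2*pi} \<inter> Q) = emeasure lborel ({0..<2*pi} \<inter> Q)"
    if [measurable]: "Q \<in> sets borel" for Q
    by (rule emeasure_eq_AE) (use AE_lborel_singleton[of "2*pi"] in \<open>auto elim!: eventually_mono\<close>)
  define b where "b = \<beta> - of_int \<lfloor>\<beta> / (2*pi)\<rfloor> * (2*pi)"
  have b: "0 \<le> b" "b < 2*pi"
    using floor_divide_lower[of "2*pi" \<beta>] floor_divide_upper[of "2*pi" \<beta>]
    by (auto simp: b_def algebra_simps)
  have eq: "\<theta> + \<beta> \<in> P \<longleftrightarrow> \<theta> + b \<in> P" for \<theta>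
    using per'[of "\<theta> + b" "\<lfloor>\<beta> / (2*pi)\<rfloor>"] by (simp add: b_def algebra_simps)
  have mb [measurable]: "{\<theta>. \<theta> + b \<in> P} \<in> sets borel"
    using measurable_sets_borel[of "\<lambda>\<theta>. \<theta> + b" borel P] by (simp add: vimage_def)
  have "emeasure lborel ({0..2*pi} \<inter> {\<theta>. \<theta> + \<beta> \<in> P}) = emeasure lborel ({0..<2*pi} \<inter> {\<theta>. \<theta> + b \<in> P})"
    using ae[OF mb] by (simp add: eq)
  also have "\<dots> = emeasure lborel {\<theta>. \<theta> + b \<in> {b..<b+2*pi} \<inter> P}"
    by (intro arg_cong[where f = "emeasure lborel"]) auto
  also have "\<dots> = emeasure lborel ({b..<b+2*pi} \<inter> P)" by (rule shift) simp
  also have "\<dots> = emeasure lborel ({b..<2*pi} \<inter> P \<union> {2*pi..<b+2*pi} \<inter> P)"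
    using b by (intro arg_cong[where f = "emeasure lborel"]) auto
  also have "\<dots> = emeasure lborel ({b..<2*pi} \<inter> P) + emeasure lborel ({2*pi..<b+2*pi} \<inter> P)"
    by (intro plus_emeasure[symmetric]) auto
  also have "emeasure lborel ({2*pi..<b+2*pi} \<inter> P) = emeasure lborel {\<theta>. \<theta> + 2*pi \<in> {2*pi..<b+2*pi} \<inter> P}"
    by (rule shift[symmetric]) simp
  also have "{\<theta>. \<theta> + 2*pi \<in> {2*pi..<b+2*pi} \<inter> P} = {0..<b} \<inter> P" by (auto simp: per)
  also have "emeasure lborel ({b..<2*pi} \<inter> P) + emeasure lborel ({0..<b} \<inter> P)
      = emeasure lborel ({b..<2*pi} \<inter> P \<union> {0..<b} \<inter> P)"
    by (intro plus_emeasure) auto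
  also have "{b..<2*pi} \<inter> P \<union> {0..<b} \<inter> P = {0..<2*pi} \<inter> P" using b by auto
  finally show ?thesis by (simp add: ae)
qed

lemma rotation_matrix_dir:
  assumes "rotation_matrix (Q :: real^2^2)"
  obtains \<beta> where "\<And>\<theta>. Q *v dir \<theta> = dir (\<theta> + \<beta>)"
proof -
  have o: "transpose Q ** Q = mat 1" and d: "det Q = 1"
    using assms by (auto simp: rotation_matrix_def orthogonal_matrix_def)
  have e: "Q$1$1 * Q$1$1 + Q$2$1 * Q$2$1 = 1" "Q$1$1 * Q$1$2 + Q$2$1 * Q$2$2 = 0"
    "Q$1$2 * Q$1$2 + Q$2$2 * Q$2$2 = 1"
    using o by (auto simp: vec_eq_iff forall_2 matrix_matrix_mult_def transpose_def mat_def sum_2)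
  have d': "Q$1$1 * Q$2$2 - Q$1$2 * Q$2$1 = 1" using d by (simp add: det_2)
  have "Q$2$2 = Q$1$1" "Q$1$2 = - Q$2$1" using e d' by algebra+
  moreover obtain \<beta> where "Q$1$1 = cos \<beta>" "Q$2$1 = sin \<beta>"
    using sincos_total_2pi[of "Q$1$1" "Q$2$1"] e(1) by (metis power2_eq_square)
  ultimately have "Q *v dir \<theta> = dir (\<theta> + \<beta>)" for \<theta>
    by (simp add: vec_eq_iff forall_2 dir_def matrix_vector_mult_def sum_2 cos_add sin_add algebra_simps)
  thus ?thesis using that by blast
qed

lemma image_rotation_span:
  "(*v) (Q :: real^2^2) ` span {v} = span {Q *v v}"
  using linear_span_image[of "(*v) Q" "{v}"] by simp

lemma emeasure_G21_measure_shift: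
  assumes A: "A \<in> sets G21_sigma"
  shows "(\<integral>\<^sup>+\<theta>. indicator A (span {dir (\<theta> + \<beta>)}) \<partial>angle_measure) = emeasure G21_measure A"
proof -
  define P where "P = {\<theta>. span {dir \<theta>} \<in> A}"
  have P [measurable]: "P \<in> sets borel"
    using measurable_sets_borel[OF measurable_span_dir A] by (simp add: P_def vimage_def)
  have per: "\<theta> + 2*pi \<in> P \<longleftrightarrow> \<theta> \<in> P" for \<theta> by (simp add: P_def dir_def)
  have mb: "{\<theta>. \<theta> + b \<in> P} \<in> sets borel" for b
    using measurable_sets_borel[of "\<lambda>\<theta>. \<theta> + b" borel P] by (simp add: vimage_def)
  have "(\<integral>\<^sup>+\<theta>. indicator A (span {dir (\<theta> + b)}) \<partial>angle_measure) =
      emeasure angle_measure {\<theta>. \<theta> + b \<in> P}" for b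
  proof -
    have "emeasure angle_measure {\<theta>. \<theta> + b \<in> P} = (\<integral>\<^sup>+\<theta>. indicator {\<theta>. \<theta> + b \<in> P} \<theta> \<partial>angle_measure)"
      using mb by (intro nn_integral_indicator[symmetric]) simp
    also have "\<dots> = (\<integral>\<^sup>+\<theta>. indicator A (span {dir (\<theta> + b)}) \<partial>angle_measure)"
      by (intro nn_integral_cong) (auto simp: P_def indicator_def)
    finally show ?thesis ..
  qed
  also have "emeasure angle_measure {\<theta>. \<theta> + b \<in> P} = emeasure angle_measure P" for b
    using mb by (simp add: emeasure_uniform_measure emeasure_periodic_shift[OF P per])
  also have "emeasure angle_measure P = emeasure G21_measure A"
    unfolding G21_measure_def using A
    by (subst emeasure_distr) (auto simp: P_def vimage_def)
  finally show ?thesis .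
qed

lemma measurable_rotation_G21:
  assumes "rotation_matrix (Q :: real^2^2)"
  shows "(`) ((*v) Q) \<in> G21_sigma \<rightarrow>\<^sub>M G21_sigma"
proof -
  have n: "norm (Q *v v) = 1" if "norm v = 1" for v
    using that assms orthogonal_transformation_matrix[of "(*v) Q"]
    by (simp add: rotation_matrix_def orthogonal_transformation_norm)
  have "(\<lambda>v. Q *v v) \<in> restrict_space borel (sphere 0 1) \<rightarrow>\<^sub>M restrict_space borel (sphere 0 1)"
    by (intro measurable_restrict_space3 borel_measurable_continuous_onI) (auto simp: n matrix_vector_mult_linear_continuous_on)
  from measurable_compose[OF this measurable_span_sphere] show ?thesis
    by (simp add: measurable_G21_sigma image_rotation_span)
qed

theorem G21_measure_rotation_invariant:
  assumes Q: "rotation_matrix (Q :: real^2^2)"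
  shows "distr G21_measure G21_sigma ((`) ((*v) Q)) = G21_measure"
proof (rule measure_eqI)
  fix A assume "A \<in> sets (distr G21_measure G21_sigma ((`) ((*v) Q)))"
  hence A: "A \<in> sets G21_sigma" by simp
  obtain \<beta> where \<beta>: "\<And>\<theta>. Q *v dir \<theta> = dir (\<theta> + \<beta>)" using rotation_matrix_dir[OF Q] by blast
  have m: "(`) ((*v) Q) \<in> G21_measure \<rightarrow>\<^sub>M G21_sigma"
    using measurable_rotation_G21[OF Q] by (simp add: G21_measure_def)
  have "emeasure (distr G21_measure G21_sigma ((`) ((*v) Q))) A
      = (\<integral>\<^sup>+\<zeta>. indicator A ((*v) Q ` \<zeta>) \<partial>G21_measure)"
    using A by (subst nn_integral_distr[OF m, symmetric]) auto
  also have "\<dots> = (\<integral>\<^sup>+\<theta>. indicator A (span {dir (\<theta> + \<beta>)}) \<partial>angle_measure)"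
    unfolding G21_measure_def using measurable_compose[OF measurable_rotation_G21[OF Q] borel_measurable_indicator[OF A]]
    by (subst nn_integral_distr) (auto simp: image_rotation_span \<beta>)
  also have "\<dots> = emeasure G21_measure A" by (rule emeasure_G21_measure_shift[OF A])
  finally show "emeasure (distr G21_measure G21_sigma ((`) ((*v) Q))) A = emeasure G21_measure A" .
qed (simp add: G21_measure_def)


theorem G21_measure_unique:
  assumes sets: "sets \<nu> = sets G21_sigma" and "prob_space \<nu>"
    and inv: "\<And>Q :: real^2^2. rotation_matrix Q \<Longrightarrow> distr \<nu> G21_sigma ((`) ((*v) Q)) = \<nu>"
  shows "\<nu> = G21_measure"
proof (rule measure_eqI)
  interpret \<nu>: prob_space \<nu> by fact
  interpret angle: prob_space angle_measure by (rule prob_space_angle)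
  interpret pair_sigma_finite angle_measure \<nu> ..
  have space: "space \<nu> = G21" using sets_eq_imp_space_eq[OF sets] by simp
  have cong: "measurable \<nu> M = measurable G21_sigma M" for M :: "'z measure"
    by (rule measurable_cong_sets[OF sets refl])
  define rot :: "real \<Rightarrow> real^2^2" where "rot \<alpha> = vector [vector [cos \<alpha>, - sin \<alpha>], vector [sin \<alpha>, cos \<alpha>]]" for \<alpha>
  have rot_dir: "rot \<alpha> *v dir \<theta> = dir (\<theta> + \<alpha>)" for \<alpha> \<theta>
    by (simp add: rot_def vec_eq_iff forall_2 dir_def matrix_vector_mult_def sum_2 cos_add sin_add algebra_simps)
  have rot: "rotation_matrix (rot \<alpha>)" for \<alpha>
    by (auto simp: rotation_matrix_def orthogonal_matrix rot_def det_2 vec_eq_iff forall_2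
        matrix_matrix_mult_def transpose_def mat_def sum_2 simp flip: power2_eq_square)
  define H where "H = {u :: real^2. u$2 > 0 \<or> (u$2 = 0 \<and> u$1 > 0)}"
  have H [measurable]: "H \<in> sets borel"
    unfolding H_def by measurable
  have H_neg: "- u \<in> H \<longleftrightarrow> u \<notin> H" if "norm u = 1" for u
  proof -
    have "u \<noteq> 0" using that by auto
    hence "u$1 \<noteq> 0 \<or> u$2 \<noteq> 0" by (simp add: vec_eq_iff forall_2)
    thus ?thesis by (auto simp: H_def)
  qed
  define sel where "sel \<zeta> = (THE u. u \<in> \<zeta> \<and> norm u = 1 \<and> u \<in> H)" for \<zeta> :: "(real^2) set"
  have sel_span: "sel (span {v}) = (if v \<in> H then v else - v)" if v: "norm v = 1" for v
    unfolding sel_def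
  proof (rule the_equality)
    show "(if v \<in> H then v else - v) \<in> span {v} \<and> norm (if v \<in> H then v else - v) = 1 \<and>
        (if v \<in> H then v else - v) \<in> H"
      using v H_neg[OF v] by (auto intro: span_base span_neg)
  next
    fix u assume u: "u \<in> span {v} \<and> norm u = 1 \<and> u \<in> H"
    then obtain k where k: "u = k *\<^sub>R v" by (auto simp: span_singleton)
    with u v have "\<bar>k\<bar> = 1" by simp
    hence "k = 1 \<or> k = -1" by linarith
    thus "u = (if v \<in> H then v else - v)" using k u H_neg[OF v] by auto
  qed
  have span_sel: "span {sel (span {v})} = span {v}" if v: "norm v = 1" for v
  proof -
    have "sel (span {v}) \<in> span {v}" "norm (sel (span {v})) = 1"
      using v by (auto simp: sel_span[OF v] intro: span_base span_neg)
    thus ?thesis using G21_spanE[OF span_in_G21[OF v]] by blast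
  qed
  have "(\<lambda>v. if v \<in> H then v else - v) \<in> restrict_space borel (sphere (0::real^2) 1) \<rightarrow>\<^sub>M borel"
    by (rule measurable_restrict_space1) measurable
  hence "(\<lambda>v. sel (span {v})) \<in> restrict_space borel (sphere 0 1) \<rightarrow>\<^sub>M borel"
    by (rule measurable_cong[THEN iffD1, rotated]) (auto simp: space_restrict_space sel_span)
  hence sel: "sel \<in> G21_sigma \<rightarrow>\<^sub>M borel" by (simp add: measurable_G21_sigma)
  have nsel: "norm (sel \<zeta>) = 1" and ssel: "span {sel \<zeta>} = \<zeta>" if "\<zeta> \<in> G21" for \<zeta>
    using that sel_span span_sel by (auto simp: G21_iff_dir)

  fix A assume "A \<in> sets \<nu>"
  hence A: "A \<in> sets G21_sigma" by (simp add: sets)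
  let ?F = "\<lambda>\<alpha> \<zeta>. indicator A ((*v) (rot \<alpha>) ` \<zeta>) :: ennreal"
  have "(\<lambda>p. vector [cos (fst p) * sel (snd p) $ 1 - sin (fst p) * sel (snd p) $ 2,
        sin (fst p) * sel (snd p) $ 1 + cos (fst p) * sel (snd p) $ 2] :: real^2)
      \<in> borel \<Otimes>\<^sub>M G21_sigma \<rightarrow>\<^sub>M borel"
  proof -
    note [measurable] = sel
    have [measurable]: "(\<lambda>v :: real^2. v $ i) \<in> borel \<rightarrow>\<^sub>M borel" for i
      by (intro borel_measurable_continuous_onI continuous_intros)
    show ?thesis by measurable
  qed
  also have "(\<lambda>p. vector [cos (fst p) * sel (snd p) $ 1 - sin (fst p) * sel (snd p) $ 2,
        sin (fst p) * sel (snd p) $ 1 + cos (fst p) * sel (snd p) $ 2] :: real^2) =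
      (\<lambda>p. rot (fst p) *v sel (snd p))"
    by (auto simp: rot_def vec_eq_iff forall_2 matrix_vector_mult_def sum_2)
  finally have m: "(\<lambda>p. rot (fst p) *v sel (snd p)) \<in> borel \<Otimes>\<^sub>M G21_sigma \<rightarrow>\<^sub>M borel" .
  have nrot: "norm (rot \<alpha> *v u) = 1" if "norm u = 1" for \<alpha> u
    using that rot[of \<alpha>] orthogonal_transformation_matrix[of "(*v) (rot \<alpha>)"]
    by (simp add: rotation_matrix_def orthogonal_transformation_norm)
  have "(\<lambda>p. span {rot (fst p) *v sel (snd p)}) \<in> borel \<Otimes>\<^sub>M G21_sigma \<rightarrow>\<^sub>M G21_sigma"
    by (rule measurable_compose[OF _ measurable_span_sphere], rule measurable_restrict_space2[OF _ m])
      (auto simp: space_pair_measure nrot nsel)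
  from measurable_compose[OF this borel_measurable_indicator[OF A]]
  have "(\<lambda>p. ?F (fst p) (snd p)) \<in> borel_measurable (borel \<Otimes>\<^sub>M G21_sigma)"
    by (rule measurable_cong[THEN iffD1, rotated])
      (auto simp: space_pair_measure ssel simp flip: image_rotation_span)
  hence F: "case_prod ?F \<in> borel_measurable (angle_measure \<Otimes>\<^sub>M \<nu>)"
    by (simp add: case_prod_beta' sets cong: measurable_cong_sets sets_pair_measure_cong)

  have "emeasure \<nu> A = (\<integral>\<^sup>+\<zeta>. ?F \<alpha> \<zeta> \<partial>\<nu>)" for \<alpha>
  proof -
    have "emeasure \<nu> A = (\<integral>\<^sup>+\<zeta>. indicator A \<zeta> \<partial>distr \<nu> G21_sigma ((`) ((*v) (rot \<alpha>))))"
      using A by (simp add: inv[OF rot] sets)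
    also have "\<dots> = (\<integral>\<^sup>+\<zeta>. ?F \<alpha> \<zeta> \<partial>\<nu>)"
      using A measurable_rotation_G21[OF rot, of \<alpha>] by (intro nn_integral_distr) (auto simp: cong)
    finally show ?thesis .
  qed
  hence "emeasure \<nu> A = (\<integral>\<^sup>+\<alpha>. (\<integral>\<^sup>+\<zeta>. ?F \<alpha> \<zeta> \<partial>\<nu>) \<partial>angle_measure)"
    by (subst nn_integral_cong[of angle_measure _ "\<lambda>_. emeasure \<nu> A"])
      (auto simp: angle.emeasure_space_1 simp del: space_uniform_measure)
  also have "\<dots> = (\<integral>\<^sup>+\<zeta>. (\<integral>\<^sup>+\<alpha>. ?F \<alpha> \<zeta> \<partial>angle_measure) \<partial>\<nu>)"
    by (rule Fubini'[OF F, symmetric])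
  also have "\<dots> = (\<integral>\<^sup>+\<zeta>. emeasure G21_measure A \<partial>\<nu>)"
  proof (rule nn_integral_cong)
    fix \<zeta> assume "\<zeta> \<in> space \<nu>"
    then obtain \<theta> where "\<zeta> = span {dir \<theta>}" by (auto simp: space G21_iff_dir)
    thus "(\<integral>\<^sup>+\<alpha>. ?F \<alpha> \<zeta> \<partial>angle_measure) = emeasure G21_measure A"
      using emeasure_G21_measure_shift[OF A, of \<theta>]
      by (simp add: image_rotation_span rot_dir add.commute)
  qed
  also have "\<dots> = emeasure G21_measure A" by (simp add: \<nu>.emeasure_space_1)
  finally show "emeasure \<nu> A = emeasure G21_measure A" .
qed (simp add: G21_measure_def sets)

end

theory Submission
  imports Defs
begin

text \<open>
  A line is given by the angle \<open>\<theta>\<close> of its direction and its signed offset \<open>t\<close> along the normal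
  \<open>nrm \<theta>\<close>; a third coordinate \<open>s\<close> marks a point on the line. For fixed \<open>\<theta>\<close> the map
  \<open>(t, s) \<mapsto> s dir \<theta> + t nrm \<theta>\<close> is an isometry of the plane, so the measure \<open>d\<theta> dt ds\<close> on pairs of
  a line and a point on it is also the measure \<open>d\<theta> dy\<close> on pairs of a direction and a point
  (\<open>flag_measure\<close>). Fubini's theorem on both sides shows that integrating \<open>\<phi> \<tau> * radon f \<tau>\<close> over all
  lines amounts to integrating \<open>f y\<close> against the mean of \<open>\<phi>\<close> over the lines through \<open>y\<close>
  (\<open>radon_duality\<close>).

  For \<open>\<phi> \<tau> = w (|x - \<tau>| / a)\<close> that mean is the mean of \<open>w |v \<bullet> nrm \<theta>|\<close> over a uniform angle, where
  \<open>v = (x - y) / a\<close>. The number \<open>|v \<bullet> nrm \<theta>|\<close> is \<open>r = |v|\<close> times the absolute sine of a uniform angle,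
  so it has the arcsine density \<open>(2 / \<pi>) (r^2 - s^2)^(-1/2)\<close> on \<open>(0, r)\<close> (\<open>arcsine_law\<close>), and the mean of \<open>w\<close>
  is the left-hand side of the Abel equation at \<open>r\<close>. The same integral
  (\<open>ball_wavelet_abel_integral\<close>) therefore solves the equation and evaluates the wavelet transform.
  It equals \<open>1\<close> for \<open>r \<le> 1\<close> and \<open>0\<close> for \<open>r > 1\<close>: in the second case the summands \<open>1\<close> and
  \<open>- s / sqrt (s^2 - 1)\<close> of \<open>w\<close> contribute \<open>1\<close> and \<open>- 1\<close>. What is left of the integral over \<open>y\<close> is
  the disc \<open>|x - y| \<le> a\<close>, which a dilation turns into the unit disc.

  Although \<open>w\<close> is singular at \<open>1\<close>, all integrals converge absolutely. Since \<open>w \<le> 1\<close>,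
  the function \<open>|w|\<close> is at most \<open>2 - w\<close>, whose mean is at most \<open>2\<close>; so the iterated integral of
  \<open>|w| |f|\<close> is at most twice the \<open>L^1\<close> norm of \<open>f\<close>.
\<close>

section \<open>Pairs of a line and a point on it\<close>

text \<open>The coordinates \<open>(t, s)\<close> are the cartesian ones followed by an orthogonal map, and orthogonal
  maps preserve Lebesgue measure.\<close>

lemma line_distr_plane:
  "distr (lborel \<Otimes>\<^sub>M lborel) borel (\<lambda>q. snd q *\<^sub>R dir \<theta> + fst q *\<^sub>R nrm \<theta>) = lborel"
proof -
  have pair: "distr (lborel \<Otimes>\<^sub>M lborel) borel (\<lambda>q. vector [fst q, snd q] :: real^2) = lborel"
  proof (rule lborel_eqI[symmetric])
    fix l u :: "real^2" assume le: "\<And>b. b \<in> Basis \<Longrightarrow> l \<bullet> b \<le> u \<bullet> b"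
    have le': "l $ i \<le> u $ i" for i
      using le[of "axis i 1"] by (auto simp: Basis_vec_def inner_axis)
    have B: "(Basis :: (real^2) set) = {axis 1 1, axis 2 1}"
      by (auto simp: Basis_vec_def UNIV_2)
    have "emeasure (distr (lborel \<Otimes>\<^sub>M lborel) borel (\<lambda>q. vector [fst q, snd q] :: real^2)) (box l u)
        = emeasure (lborel \<Otimes>\<^sub>M lborel) ({l$1<..<u$1} \<times> {l$2<..<u$2})"
      by (subst emeasure_distr)
        (auto simp: case_prod_beta' space_pair_measure mem_box_cart forall_2
           intro!: arg_cong[where f = "emeasure (lborel \<Otimes>\<^sub>M lborel)"])
    also have "\<dots> = ennreal (u$1 - l$1) * ennreal (u$2 - l$2)"
      using le' by (simp add: lborel.emeasure_pair_measure_Times)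
    also have "\<dots> = (\<Prod>b\<in>Basis. (u - l) \<bullet> b)"
      using le' by (simp add: B inner_axis axis_eq_axis ennreal_mult)
    finally show "emeasure (distr (lborel \<Otimes>\<^sub>M lborel) borel (\<lambda>q. vector [fst q, snd q] :: real^2)) (box l u)
        = (\<Prod>b\<in>Basis. (u - l) \<bullet> b)" .
  qed simp
  define T :: "real^2 \<Rightarrow> real^2" where "T v = v$2 *\<^sub>R dir \<theta> + v$1 *\<^sub>R nrm \<theta>" for v
  \<comment> \<open>The inverse of \<open>T\<close>: preimages under \<open>T\<close> become images under an orthogonal map.\<close>
  define T' :: "real^2 \<Rightarrow> real^2" where "T' v = vector [v \<bullet> nrm \<theta>, v \<bullet> dir \<theta>]" for v
  have cs: "cos \<theta> * cos \<theta> = 1 - sin \<theta> * sin \<theta>"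
    using sin_cos_squared_add3[of \<theta>] by linarith
  have T'T: "T' (T v) = v" and TT': "T (T' v) = v" for v
    using cs by (simp_all add: T_def T'_def vec_eq_iff forall_2 dir_def nrm_def inner_vec_def sum_2) algebra+
  have orth: "orthogonal_transformation T'"
    unfolding orthogonal_transformation_def
  proof (intro conjI allI)
    show "linear T'"
      by (rule linearI) (auto simp: T'_def vec_eq_iff forall_2 inner_add_left)
    show "T' v \<bullet> T' w = v \<bullet> w" for v w
      using cs by (simp add: T'_def dir_def nrm_def inner_vec_def sum_2) algebra
  qed
  have T_measurable [measurable]: "T \<in> borel \<rightarrow>\<^sub>M borel"
    unfolding T_def by (intro borel_measurable_continuous_onI continuous_intros)
  have "distr lborel borel T = lborel"
  proof (rule lborel_eqI[symmetric])
    fix l u :: "real^2" assume le: "\<And>b. b \<in> Basis \<Longrightarrow> l \<bullet> b \<le> u \<bullet> b"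
    have vim: "T -` box l u = T' ` box l u"
      by (auto simp: TT' intro!: rev_image_eqI T'T[symmetric])
    have lm: "box l u \<in> lmeasurable" by simp
    have "emeasure (distr lborel borel T) (box l u) = emeasure lebesgue (T' ` box l u)"
      using measurable_sets_borel[OF T_measurable, of "box l u"] by (simp add: emeasure_distr flip: vim)
    also have "\<dots> = emeasure lebesgue (box l u)"
      using measure_orthogonal_image[OF orth lm] measurable_orthogonal_image[OF orth lm] lm
      by (simp add: emeasure_eq_measure2 fmeasurableD2)
    finally show "emeasure (distr lborel borel T) (box l u) = (\<Prod>b\<in>Basis. (u - l) \<bullet> b)"
      using le by (simp add: emeasure_lborel_box)
  qed simp
  also have "distr lborel borel T = distr (lborel \<Otimes>\<^sub>M lborel) borel (\<lambda>q. snd q *\<^sub>R dir \<theta> + fst q *\<^sub>R nrm \<theta>)"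
    by (subst pair[symmetric], subst distr_distr)
       (auto simp: T_def o_def case_prod_beta' intro!: distr_cong)
  finally show ?thesis .
qed

text \<open>Read from right to left, this replaces an integral over directions and points of the plane by one
  over lines and points on them; no Jacobian appears because each slice \<open>\<theta> = const\<close> is mapped
  isometrically.\<close>

lemma flag_measure:
  "distr ((angle_measure \<Otimes>\<^sub>M lborel) \<Otimes>\<^sub>M lborel) (angle_measure \<Otimes>\<^sub>M lborel)
     (\<lambda>p. (fst (fst p), snd p *\<^sub>R dir (fst (fst p)) + snd (fst p) *\<^sub>R nrm (fst (fst p))))
   = angle_measure \<Otimes>\<^sub>M lborel" (is "distr ?M ?N ?F = _")
proof (rule pair_measure_eqI[symmetric])
  interpret angle: prob_space angle_measure by (rule prob_space_angle)
  interpret AL: pair_sigma_finite angle_measure "lborel :: real measure" ..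
  interpret LL: pair_sigma_finite "lborel :: real measure" "lborel :: real measure" ..
  show "sigma_finite_measure angle_measure" ..
  show "sigma_finite_measure (lborel :: (real^2) measure)" ..
  show "sets (angle_measure \<Otimes>\<^sub>M lborel) = sets (distr ?M ?N ?F)" by simp
  have F [measurable]: "?F \<in> ?M \<rightarrow>\<^sub>M ?N" by measurable
  fix A :: "real set" and B :: "(real^2) set"
  assume "A \<in> sets angle_measure" "B \<in> sets lborel"
  hence A [measurable]: "A \<in> sets borel" and B [measurable]: "B \<in> sets borel" by auto
  have "emeasure (distr ?M ?N ?F) (A \<times> B) = (\<integral>\<^sup>+p. indicator (A \<times> B) p \<partial>distr ?M ?N ?F)"
    by simp
  also have "\<dots> = (\<integral>\<^sup>+p. indicator (A \<times> B) (?F p) \<partial>?M)"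
    by (rule nn_integral_distr[OF F]) simp
  also have "\<dots> = (\<integral>\<^sup>+q. (\<integral>\<^sup>+s. indicator (A \<times> B) (?F (q, s)) \<partial>lborel) \<partial>(angle_measure \<Otimes>\<^sub>M lborel))"
    by (rule lborel.nn_integral_fst[symmetric]) measurable
  also have "\<dots> = (\<integral>\<^sup>+\<theta>. (\<integral>\<^sup>+t. (\<integral>\<^sup>+s. indicator (A \<times> B) (?F ((\<theta>, t), s)) \<partial>lborel) \<partial>lborel) \<partial>angle_measure)"
    by (rule lborel.nn_integral_fst[symmetric]) measurable
  also have "\<dots> = (\<integral>\<^sup>+\<theta>. indicator A \<theta> * emeasure lborel B \<partial>angle_measure)"
  proof (rule nn_integral_cong)
    fix \<theta> :: real
    have "(\<integral>\<^sup>+t. (\<integral>\<^sup>+s. indicator (A \<times> B) (?F ((\<theta>, t), s)) \<partial>lborel) \<partial>lborel)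
        = (\<integral>\<^sup>+t. (\<integral>\<^sup>+s. indicator A \<theta> * indicator B (s *\<^sub>R dir \<theta> + t *\<^sub>R nrm \<theta>) \<partial>lborel) \<partial>lborel)"
      by (simp add: indicator_times)
    also have "\<dots> = indicator A \<theta> * (\<integral>\<^sup>+t. (\<integral>\<^sup>+s. indicator B (s *\<^sub>R dir \<theta> + t *\<^sub>R nrm \<theta>) \<partial>lborel) \<partial>lborel)"
      by (simp add: nn_integral_cmult)
    also have "(\<integral>\<^sup>+t. (\<integral>\<^sup>+s. indicator B (s *\<^sub>R dir \<theta> + t *\<^sub>R nrm \<theta>) \<partial>lborel) \<partial>lborel)
        = (\<integral>\<^sup>+p. indicator B (snd p *\<^sub>R dir \<theta> + fst p *\<^sub>R nrm \<theta>) \<partial>(lborel \<Otimes>\<^sub>M lborel))"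
      by (subst lborel.nn_integral_fst[symmetric]) simp_all
    also have "\<dots> = (\<integral>\<^sup>+y. indicator B y \<partial>distr (lborel \<Otimes>\<^sub>M lborel) borel (\<lambda>q. snd q *\<^sub>R dir \<theta> + fst q *\<^sub>R nrm \<theta>))"
      by (rule nn_integral_distr[symmetric]) measurable
    also have "\<dots> = emeasure lborel B" by (simp add: line_distr_plane)
    finally show "(\<integral>\<^sup>+t. (\<integral>\<^sup>+s. indicator (A \<times> B) (?F ((\<theta>, t), s)) \<partial>lborel) \<partial>lborel)
        = indicator A \<theta> * emeasure lborel B" .
  qed
  also have "\<dots> = emeasure angle_measure A * emeasure lborel B"
    by (simp add: nn_integral_multc)
  finally show "emeasure angle_measure A * emeasure lborel B = emeasure (distr ?M ?N ?F) (A \<times> B)" ..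
qed

section \<open>Measurability on the space of lines\<close>

text \<open>A measurable choice of a unit vector on each line: the one that points to the right, or upwards if
  the line is vertical. Through it, functions of a line whose definition involves a direction are
  seen to be measurable; an arbitrary choice of unit vectors would not give this.\<close>

definition pos_unit :: "(real^2) set \<Rightarrow> real^2"
  where "pos_unit \<zeta> = (THE u. u \<in> \<zeta> \<and> norm u = 1 \<and> (u$1 > 0 \<or> (u$1 = 0 \<and> u$2 > 0)))"

lemma pos_unit_span:
  assumes v: "norm v = 1"
  shows "pos_unit (span {v}) = (if v$1 > 0 \<or> (v$1 = 0 \<and> v$2 > 0) then v else - v)"
  unfolding pos_unit_def
proof (rule the_equality)
  have "v \<noteq> 0" using v by auto
  hence "v$1 \<noteq> 0 \<or> v$2 \<noteq> 0" by (simp add: vec_eq_iff forall_2)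
  thus "(if v$1 > 0 \<or> (v$1 = 0 \<and> v$2 > 0) then v else - v) \<in> span {v} \<and>
      norm (if v$1 > 0 \<or> (v$1 = 0 \<and> v$2 > 0) then v else - v) = 1 \<and>
      ((if v$1 > 0 \<or> (v$1 = 0 \<and> v$2 > 0) then v else - v)$1 > 0 \<or>
       (if v$1 > 0 \<or> (v$1 = 0 \<and> v$2 > 0) then v else - v)$1 = 0 \<and>
       (if v$1 > 0 \<or> (v$1 = 0 \<and> v$2 > 0) then v else - v)$2 > 0)"
    using v by (auto intro: span_base span_neg)
next
  fix u assume u: "u \<in> span {v} \<and> norm u = 1 \<and> (u$1 > 0 \<or> (u$1 = 0 \<and> u$2 > 0))"
  then obtain k where k: "u = k *\<^sub>R v" by (auto simp: span_singleton)
  with u v have "\<bar>k\<bar> = 1" by simp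
  hence "k = 1 \<or> k = -1" by linarith
  thus "u = (if v$1 > 0 \<or> (v$1 = 0 \<and> v$2 > 0) then v else - v)" using k u by auto
qed

lemma norm_pos_unit: "\<zeta> \<in> G21 \<Longrightarrow> norm (pos_unit \<zeta>) = 1"
  and span_pos_unit: "\<zeta> \<in> G21 \<Longrightarrow> span {pos_unit \<zeta>} = \<zeta>"
proof -
  assume "\<zeta> \<in> G21"
  then obtain v where v: "norm v = 1" "\<zeta> = span {v}" using G21_iff_dir norm_dir by blast
  show n: "norm (pos_unit \<zeta>) = 1" using v by (simp add: pos_unit_span)
  have "pos_unit \<zeta> \<in> \<zeta>" using v by (auto simp: pos_unit_span intro: span_base span_neg)
  thus "span {pos_unit \<zeta>} = \<zeta>" using G21_spanE[OF \<open>\<zeta> \<in> G21\<close> _ n] by simp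
qed

lemma borel_measurable_nth2 [measurable]: "(\<lambda>v::real^2. v $ i) \<in> borel_measurable borel"
  by (intro borel_measurable_continuous_onI continuous_intros)

lemma measurable_pos_unit: "pos_unit \<in> G21_sigma \<rightarrow>\<^sub>M borel"
  unfolding measurable_G21_sigma
proof (rule measurable_cong[THEN iffD2])
  show "(\<lambda>v. if v$1 > 0 \<or> (v$1 = 0 \<and> v$2 > 0) then v else - v)
      \<in> restrict_space borel (sphere (0::real^2) 1) \<rightarrow>\<^sub>M borel"
    by (rule measurable_restrict_space1) measurable
qed (auto simp: space_restrict_space pos_unit_span)

lemma measurable_A21_pos_unit [measurable]: "(\<lambda>\<tau>. pos_unit (fst \<tau>)) \<in> A21_sigma \<rightarrow>\<^sub>M borel"
  and measurable_A21_snd [measurable]: "snd \<in> A21_sigma \<rightarrow>\<^sub>M borel"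
  unfolding A21_sigma_def
  by (auto intro!: measurable_restrict_space1 measurable_compose[OF measurable_fst measurable_pos_unit])

lemma radon_span:
  fixes f :: "real^2 \<Rightarrow> 'b::{banach,second_countable_topology}"
  assumes u: "norm u = 1" and [measurable]: "f \<in> borel_measurable borel"
  shows "radon f (span {u}, p) = (\<integral>s. f (s *\<^sub>R u + p) \<partial>lborel)"
proof -
  have "(\<lambda>x'. f (x' + p)) \<in> borel_measurable (restrict_space borel (span {u}))"
    by (rule measurable_restrict_space1) measurable
  moreover have "(\<lambda>t. t *\<^sub>R u) \<in> lborel \<rightarrow>\<^sub>M restrict_space borel (span {u})"
    by (intro measurable_restrict_space2) (auto intro: span_scale span_base)
  ultimately show ?thesis
    by (simp add: radon_def line_lebesgue_span[OF u] integral_distr)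
qed

text \<open>The nearest point on the line is the orthogonal projection, because
  \<open>|q - s u|^2 = |q - (q \<bullet> u) u|^2 + (q \<bullet> u - s)^2\<close>.\<close>

lemma infdist_line_of_span:
  assumes u: "norm u = 1"
  shows "infdist x (line_of (span {u}, p)) = norm (x - p - ((x - p) \<bullet> u) *\<^sub>R u)"
proof (rule antisym)
  let ?q = "x - p"
  have "(?q \<bullet> u) *\<^sub>R u + p \<in> line_of (span {u}, p)"
    by (auto simp: line_of_def span_singleton)
  from infdist_le[OF this, of x]
  show "infdist x (line_of (span {u}, p)) \<le> norm (?q - (?q \<bullet> u) *\<^sub>R u)"
    by (simp add: dist_norm algebra_simps)
  have uu: "u \<bullet> u = 1" using u by (simp add: dot_square_norm)
  have "norm (?q - (?q \<bullet> u) *\<^sub>R u) \<le> dist x y" if y: "y \<in> line_of (span {u}, p)" for y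
  proof -
    from y obtain s where y: "y = s *\<^sub>R u + p" by (auto simp: line_of_def span_singleton)
    have "(norm (?q - s *\<^sub>R u))\<^sup>2 - (norm (?q - (?q \<bullet> u) *\<^sub>R u))\<^sup>2 = (?q \<bullet> u - s)\<^sup>2"
      unfolding power2_norm_eq_inner
      by (simp add: inner_diff_left inner_diff_right uu inner_commute power2_eq_square algebra_simps)
    hence "(norm (?q - (?q \<bullet> u) *\<^sub>R u))\<^sup>2 \<le> (norm (?q - s *\<^sub>R u))\<^sup>2"
      by (metis diff_ge_0_iff_ge zero_le_power2)
    hence "norm (?q - (?q \<bullet> u) *\<^sub>R u) \<le> norm (?q - s *\<^sub>R u)" by (rule power2_le_imp_le) simp
    thus ?thesis by (simp add: y dist_norm algebra_simps)
  qed
  moreover have "line_of (span {u}, p) \<noteq> {}" by (auto simp: line_of_def intro: span_0)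
  ultimately show "norm (?q - (?q \<bullet> u) *\<^sub>R u) \<le> infdist x (line_of (span {u}, p))"
    by (auto simp: infdist_notempty intro!: cINF_greatest)
qed

lemma borel_measurable_radon:
  fixes f :: "real^2 \<Rightarrow> 'b::{banach,second_countable_topology}"
  assumes f [measurable]: "f \<in> borel_measurable borel"
  shows "radon f \<in> borel_measurable A21_sigma"
proof (rule measurable_cong[THEN iffD2])
  show "(\<lambda>\<tau>. \<integral>s. f (s *\<^sub>R pos_unit (fst \<tau>) + snd \<tau>) \<partial>lborel) \<in> borel_measurable A21_sigma"
    by measurable
  fix \<tau> assume "\<tau> \<in> space A21_sigma"
  hence "fst \<tau> \<in> G21" by (auto simp: A21_def)
  from radon_span[OF norm_pos_unit[OF this] f, of "snd \<tau>"]
  show "radon f \<tau> = (\<integral>s. f (s *\<^sub>R pos_unit (fst \<tau>) + snd \<tau>) \<partial>lborel)"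
    by (simp add: span_pos_unit[OF \<open>fst \<tau> \<in> G21\<close>])
qed

lemma borel_measurable_infdist_line:
  "(\<lambda>\<tau>. infdist x (line_of \<tau>)) \<in> borel_measurable A21_sigma"
proof (rule measurable_cong[THEN iffD2])
  show "(\<lambda>\<tau>. norm (x - snd \<tau> - ((x - snd \<tau>) \<bullet> pos_unit (fst \<tau>)) *\<^sub>R pos_unit (fst \<tau>)))
      \<in> borel_measurable A21_sigma"
    by measurable
  fix \<tau> assume "\<tau> \<in> space A21_sigma"
  hence "fst \<tau> \<in> G21" by (auto simp: A21_def)
  from infdist_line_of_span[OF norm_pos_unit[OF this], of x "snd \<tau>"]
  show "infdist x (line_of \<tau>) = norm (x - snd \<tau> - ((x - snd \<tau>) \<bullet> pos_unit (fst \<tau>)) *\<^sub>R pos_unit (fst \<tau>))"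
    by (simp add: span_pos_unit[OF \<open>fst \<tau> \<in> G21\<close>])
qed

section \<open>Duality between the Radon transform and means over lines through a point\<close>

lemma dir_nrm_decompose: "(x \<bullet> dir \<theta>) *\<^sub>R dir \<theta> + (x \<bullet> nrm \<theta>) *\<^sub>R nrm \<theta> = x"
proof -
  have "cos \<theta> * cos \<theta> = 1 - sin \<theta> * sin \<theta>" using sin_cos_squared_add3[of \<theta>] by linarith
  thus ?thesis by (simp add: vec_eq_iff forall_2 dir_def nrm_def inner_vec_def sum_2) algebra
qed

lemma inner_dir_nrm [simp]: "dir \<theta> \<bullet> nrm \<theta> = 0" "nrm \<theta> \<bullet> dir \<theta> = 0"
  by (simp_all add: dir_def nrm_def inner_vec_def sum_2)

lemma inner_nrm_self [simp]: "nrm \<theta> \<bullet> nrm \<theta> = 1"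
  by (simp add: dot_square_norm)

definition line_through :: "real \<Rightarrow> real^2 \<Rightarrow> (real^2) set \<times> (real^2)"
  where "line_through \<theta> y = (span {dir \<theta>}, (y \<bullet> nrm \<theta>) *\<^sub>R nrm \<theta>)"

lemma infdist_line_through: "infdist x (line_of (line_through \<theta> y)) = \<bar>(x - y) \<bullet> nrm \<theta>\<bar>"
proof -
  let ?q = "x - (y \<bullet> nrm \<theta>) *\<^sub>R nrm \<theta>"
  have "?q - (?q \<bullet> dir \<theta>) *\<^sub>R dir \<theta> = (?q \<bullet> nrm \<theta>) *\<^sub>R nrm \<theta>"
    using dir_nrm_decompose[of ?q \<theta>] by (simp add: algebra_simps)
  also have "?q \<bullet> nrm \<theta> = (x - y) \<bullet> nrm \<theta>" by (simp add: inner_diff_left)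
  finally show ?thesis by (simp add: line_through_def infdist_line_of_span)
qed

text \<open>The adjoint of the Radon transform is the mean over the lines through a point. Both sides are
  iterated forms of one integral over pairs of a line and a point on it, transported along
  \<open>flag_measure\<close>. Absolute convergence is assumed on the side of points, where it is easier to check.\<close>

theorem radon_duality:
  fixes f :: "real^2 \<Rightarrow> 'b::{banach,second_countable_topology}" and \<phi> :: "_ \<Rightarrow> real"
  assumes f [measurable]: "f \<in> borel_measurable borel"
    and \<phi> [measurable]: "\<phi> \<in> borel_measurable A21_sigma"
    and int: "integrable (angle_measure \<Otimes>\<^sub>M lborel) (\<lambda>p. \<phi> (line_through (fst p) (snd p)) *\<^sub>R f (snd p))"
  shows "integrable A21_measure (\<lambda>\<tau>. \<phi> \<tau> *\<^sub>R radon f \<tau>)" (is ?I)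
    and "(\<integral>\<tau>. \<phi> \<tau> *\<^sub>R radon f \<tau> \<partial>A21_measure)
       = (\<integral>y. (\<integral>\<theta>. \<phi> (line_through \<theta> y) *\<^sub>R f y \<partial>angle_measure) \<partial>lborel)" (is ?E)
proof -
  interpret angle: prob_space angle_measure by (rule prob_space_angle)
  interpret AL: pair_sigma_finite angle_measure "lborel :: real measure" ..
  interpret AP: pair_sigma_finite angle_measure "lborel :: (real^2) measure" ..
  interpret ALL: pair_sigma_finite "angle_measure \<Otimes>\<^sub>M (lborel :: real measure)" "lborel :: real measure" ..
  note [measurable] = borel_measurable_radon[OF f]
  let ?M = "angle_measure \<Otimes>\<^sub>M (lborel :: real measure)"
  let ?F = "\<lambda>p. (fst (fst p), snd p *\<^sub>R dir (fst (fst p)) + snd (fst p) *\<^sub>R nrm (fst (fst p)))"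
  let ?T = "\<lambda>(\<theta>, t). (span {dir \<theta>}, t *\<^sub>R nrm \<theta>)"
  let ?g = "\<lambda>p. \<phi> (line_through (fst p) (snd p)) *\<^sub>R f (snd p)"
  have T [measurable]: "?T \<in> ?M \<rightarrow>\<^sub>M A21_sigma"
    using measurable_A21_param
    by (simp cong: measurable_cong_sets add: sets_pair_measure_cong[of angle_measure borel lborel borel])
  have F: "?F \<in> ?M \<Otimes>\<^sub>M lborel \<rightarrow>\<^sub>M angle_measure \<Otimes>\<^sub>M lborel" by measurable
  have g: "?g \<in> borel_measurable (angle_measure \<Otimes>\<^sub>M lborel)" using int by (rule borel_measurable_integrable)
  \<comment> \<open>The line through a point of the line with parameters \<open>q\<close>, in direction \<open>fst q\<close>, is that line itself.\<close>
  have gF: "?g (?F (q, s)) = \<phi> (?T q) *\<^sub>R f (s *\<^sub>R dir (fst q) + snd q *\<^sub>R nrm (fst q))" for q s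
    by (simp add: line_through_def inner_add_left case_prod_beta')
  have slice: "(\<integral>s. ?g (?F (q, s)) \<partial>lborel) = \<phi> (?T q) *\<^sub>R radon f (?T q)" for q
    unfolding gF by (simp add: case_prod_beta' radon_span)
  have int': "integrable (?M \<Otimes>\<^sub>M lborel) (\<lambda>p. ?g (?F p))"
    using int by (subst (asm) flag_measure[symmetric]) (rule integrable_distr[OF F])
  show ?I
    unfolding A21_measure_param using ALL.integrable_fst'[OF int', unfolded slice]
    by (subst integrable_distr_eq) auto
  have "(\<integral>\<tau>. \<phi> \<tau> *\<^sub>R radon f \<tau> \<partial>A21_measure) = (\<integral>q. \<phi> (?T q) *\<^sub>R radon f (?T q) \<partial>?M)"
    unfolding A21_measure_param by (rule integral_distr) measurable
  also have "\<dots> = (\<integral>p. ?g (?F p) \<partial>(?M \<Otimes>\<^sub>M lborel))"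
    unfolding slice[symmetric] by (rule ALL.integral_fst'[OF int'])
  also have "\<dots> = (\<integral>p. ?g p \<partial>(angle_measure \<Otimes>\<^sub>M lborel))"
    using integral_distr[OF F g] by (simp add: flag_measure)
  also have "\<dots> = (\<integral>y. (\<integral>\<theta>. \<phi> (line_through \<theta> y) *\<^sub>R f y \<partial>angle_measure) \<partial>lborel)"
    using AP.integral_snd[of "\<lambda>\<theta> y. \<phi> (line_through \<theta> y) *\<^sub>R f y"] int by (simp add: case_prod_beta')
  finally show ?E .
qed

section \<open>The arcsine law\<close>

lemma powr_neg_half: "x > 0 \<Longrightarrow> x powr (-1/2) = 1 / sqrt x" for x :: real
  using powr_minus[of x "1/2"] by (simp add: powr_half_sqrt inverse_eq_divide)

definition arcsine_density :: "real \<Rightarrow> real \<Rightarrow> real"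
  where "arcsine_density r s = indicator {0<..<r} s * (2 / pi * (r\<^sup>2 - s\<^sup>2) powr (-1/2))"

lemma arcsine_density_nonneg [simp]: "0 \<le> arcsine_density r s"
  by (simp add: arcsine_density_def)

lemma borel_measurable_arcsine_density [measurable]: "arcsine_density r \<in> borel_measurable borel"
  unfolding arcsine_density_def by measurable

text \<open>The substitution \<open>s = r sin \<theta>\<close>: the derivative \<open>r cos \<theta>\<close> cancels \<open>(r^2 - s^2)^(-1/2)\<close>. The factor
  \<open>2 / \<pi>\<close> normalises the measure of the quarter turn.\<close>

lemma nn_integral_sin_quarter:
  assumes r: "r > 0" and [measurable]: "A \<in> sets borel"
  shows "(\<integral>\<^sup>+\<theta>. ennreal (2 / pi * indicator A (r * \<bar>sin \<theta>\<bar>)) * indicator {0..pi/2} \<theta> \<partial>lborel)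
       = (\<integral>\<^sup>+s. ennreal (arcsine_density r s) * indicator A s \<partial>lborel)"
proof -
  let ?f = "\<lambda>s. 2 / pi * (r\<^sup>2 - s\<^sup>2) powr (-1/2) * indicator A s"
  have "(\<integral>\<^sup>+s. ennreal (arcsine_density r s) * indicator A s \<partial>lborel)
      = (\<integral>\<^sup>+s. ennreal (?f s) * indicator {r * sin 0..r * sin (pi/2)} s \<partial>lborel)"
  proof (rule nn_integral_cong_AE)
    show "AE s in lborel. ennreal (arcsine_density r s) * indicator A s =
        ennreal (?f s) * indicator {r * sin 0..r * sin (pi/2)} s"
      using AE_lborel_singleton[of 0] AE_lborel_singleton[of r]
      by eventually_elim (auto simp: arcsine_density_def indicator_def)
  qed
  also have "\<dots> = (\<integral>\<^sup>+\<theta>. ennreal (?f (r * sin \<theta>) * (r * cos \<theta>)) * indicator {0..pi/2} \<theta> \<partial>lborel)"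
  proof -
    have ind: "ennreal (x * indicator S y) = ennreal x * indicator S y" for x y :: real and S
      by (simp add: indicator_def)
    have "set_borel_measurable borel {r * sin 0..r * sin (pi/2)} ?f"
      unfolding set_borel_measurable_def by measurable
    moreover have "((\<lambda>\<theta>. r * sin \<theta>) has_real_derivative r * cos \<theta>) (at \<theta>)" for \<theta>
      by (auto intro!: derivative_eq_intros)
    moreover have "continuous_on {0..pi/2} (\<lambda>\<theta>. r * cos \<theta>)" by (intro continuous_intros)
    moreover have "r * cos \<theta> \<ge> 0" if "\<theta> \<in> {0..pi/2}" for \<theta>
      using r that by (auto intro!: mult_nonneg_nonneg cos_ge_zero)
    ultimately have "(\<integral>\<^sup>+s. ennreal (?f s * indicator {r * sin 0..r * sin (pi/2)} s) \<partial>lborel)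
        = (\<integral>\<^sup>+\<theta>. ennreal (?f (r * sin \<theta>) * (r * cos \<theta>) * indicator {0..pi/2} \<theta>) \<partial>lborel)"
      by (rule nn_integral_substitution) auto
    thus ?thesis by (simp only: ind)
  qed
  also have "\<dots> = (\<integral>\<^sup>+\<theta>. ennreal (2 / pi * indicator A (r * \<bar>sin \<theta>\<bar>)) * indicator {0..pi/2} \<theta> \<partial>lborel)"
  proof (rule nn_integral_cong_AE)
    have eq: "?f (r * sin \<theta>) * (r * cos \<theta>) = 2 / pi * indicator A (r * \<bar>sin \<theta>\<bar>)"
      if "\<theta> \<in> {0..<pi/2}" for \<theta>
    proof -
      have c: "cos \<theta> > 0" and s: "sin \<theta> \<ge> 0"
        using that by (auto intro!: cos_gt_zero_pi sin_ge_zero)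
      have "r\<^sup>2 - (r * sin \<theta>)\<^sup>2 = r\<^sup>2 * (1 - (sin \<theta>)\<^sup>2)"
        by (simp only: power_mult_distrib right_diff_distrib mult_1_right)
      also have "\<dots> = (r * cos \<theta>)\<^sup>2"
        by (simp only: power_mult_distrib cos_squared_eq)
      finally have "r\<^sup>2 - (r * sin \<theta>)\<^sup>2 = (r * cos \<theta>)\<^sup>2" .
      hence "(r\<^sup>2 - (r * sin \<theta>)\<^sup>2) powr (-1/2) = 1 / (r * cos \<theta>)"
        using r c powr_neg_half[of "(r * cos \<theta>)\<^sup>2"] by simp
      thus ?thesis using r c s by simp
    qed
    \<comment> \<open>At \<open>\<pi>/2\<close> the identity may fail, as \<open>0 powr (-1/2)\<close> is \<open>0\<close>.\<close>
    show "AE \<theta> in lborel. ennreal (?f (r * sin \<theta>) * (r * cos \<theta>)) * indicator {0..pi/2} \<theta>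
        = ennreal (2 / pi * indicator A (r * \<bar>sin \<theta>\<bar>)) * indicator {0..pi/2} \<theta>"
      using AE_lborel_singleton[of "pi/2"]
    proof eventually_elim
      case (elim \<theta>)
      show ?case
      proof (cases "\<theta> \<in> {0..<pi/2}")
        case True
        thus ?thesis by (simp only: eq)
      next
        case False
        with elim have "\<theta> \<notin> {0..pi/2}" by auto
        thus ?thesis by simp
      qed
    qed
  qed
  finally show ?thesis ..
qed

text \<open>The absolute sine is invariant under \<open>\<theta> \<mapsto> \<pi> - \<theta>\<close>, \<open>\<theta> \<mapsto> \<pi> + \<theta>\<close> and \<open>\<theta> \<mapsto> 2 \<pi> - \<theta>\<close>, which carry
  the first quarter turn to the other three.\<close>

lemma nn_integral_full_turn:
  assumes [measurable]: "H \<in> borel_measurable borel"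
  shows "(\<integral>\<^sup>+\<theta>. H \<bar>sin \<theta>\<bar> * indicator {0..2*pi} \<theta> \<partial>lborel)
       = 4 * (\<integral>\<^sup>+\<theta>. H \<bar>sin \<theta>\<bar> * indicator {0..pi/2} \<theta> \<partial>lborel)" (is "_ = 4 * ?J")
proof -
  have piece: "(\<integral>\<^sup>+\<theta>. H \<bar>sin \<theta>\<bar> * indicator S \<theta> \<partial>lborel) = ?J"
    if [measurable]: "S \<in> sets borel" and c: "\<bar>c\<bar> = 1" and S: "\<And>\<theta>. t + c * \<theta> \<in> S \<longleftrightarrow> \<theta> \<in> {0..pi/2}"
      and sin: "\<And>\<theta>. \<bar>sin (t + c * \<theta>)\<bar> = \<bar>sin \<theta>\<bar>" for S :: "real set" and c t :: real
  proof -
    have "(\<integral>\<^sup>+\<theta>. H \<bar>sin \<theta>\<bar> * indicator S \<theta> \<partial>lborel)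
        = \<bar>c\<bar> * (\<integral>\<^sup>+\<theta>. H \<bar>sin (t + c * \<theta>)\<bar> * indicator S (t + c * \<theta>) \<partial>lborel)"
      by (rule nn_integral_real_affine) (use c in auto)
    also have "\<dots> = ?J" using S by (simp add: c sin indicator_def)
    finally show ?thesis .
  qed
  have "(\<integral>\<^sup>+\<theta>. H \<bar>sin \<theta>\<bar> * indicator {0..2*pi} \<theta> \<partial>lborel)
      = (\<integral>\<^sup>+\<theta>. H \<bar>sin \<theta>\<bar> * indicator {0..pi/2} \<theta> + (H \<bar>sin \<theta>\<bar> * indicator {pi/2..pi} \<theta> +
          (H \<bar>sin \<theta>\<bar> * indicator {pi..3*pi/2} \<theta> + H \<bar>sin \<theta>\<bar> * indicator {3*pi/2..2*pi} \<theta>)) \<partial>lborel)"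
  proof (rule nn_integral_cong_AE)
    show "AE \<theta> in lborel. H \<bar>sin \<theta>\<bar> * indicator {0..2*pi} \<theta>
      = H \<bar>sin \<theta>\<bar> * indicator {0..pi/2} \<theta> + (H \<bar>sin \<theta>\<bar> * indicator {pi/2..pi} \<theta> +
          (H \<bar>sin \<theta>\<bar> * indicator {pi..3*pi/2} \<theta> + H \<bar>sin \<theta>\<bar> * indicator {3*pi/2..2*pi} \<theta>))"
      using AE_lborel_singleton[of "pi/2"] AE_lborel_singleton[of pi] AE_lborel_singleton[of "3*pi/2"]
    proof eventually_elim
      case (elim \<theta>)
      have "indicator {0..2*pi} \<theta> = indicator {0..pi/2} \<theta> + (indicator {pi/2..pi} \<theta> +
          (indicator {pi..3*pi/2} \<theta> + indicator {3*pi/2..2*pi} \<theta> :: ennreal))"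
        using elim pi_gt_zero by (auto simp: indicator_def)
      thus ?case by (simp add: distrib_left)
    qed
  qed
  also have "\<dots> = ?J + (\<integral>\<^sup>+\<theta>. H \<bar>sin \<theta>\<bar> * indicator {pi/2..pi} \<theta> \<partial>lborel) +
      (\<integral>\<^sup>+\<theta>. H \<bar>sin \<theta>\<bar> * indicator {pi..3*pi/2} \<theta> \<partial>lborel) +
      (\<integral>\<^sup>+\<theta>. H \<bar>sin \<theta>\<bar> * indicator {3*pi/2..2*pi} \<theta> \<partial>lborel)"
    by (simp add: nn_integral_add add.assoc)
  also have "(\<integral>\<^sup>+\<theta>. H \<bar>sin \<theta>\<bar> * indicator {pi/2..pi} \<theta> \<partial>lborel) = ?J"
    by (rule piece[where c = "-1" and t = pi]) (auto simp: sin_diff)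
  also have "(\<integral>\<^sup>+\<theta>. H \<bar>sin \<theta>\<bar> * indicator {pi..3*pi/2} \<theta> \<partial>lborel) = ?J"
    by (rule piece[where c = 1 and t = pi]) (auto simp: sin_add)
  also have "(\<integral>\<^sup>+\<theta>. H \<bar>sin \<theta>\<bar> * indicator {3*pi/2..2*pi} \<theta> \<partial>lborel) = ?J"
    by (rule piece[where c = "-1" and t = "2*pi"]) (auto simp: sin_diff)
  also have "?J + ?J + ?J + ?J = 4 * ?J"
  proof -
    have "(4 :: ennreal) = 1 + 1 + 1 + 1" by simp
    thus ?thesis by (simp only: distrib_right mult_1_left)
  qed
  finally show ?thesis .
qed

text \<open>If \<open>\<alpha>\<close> is the angle of \<open>v\<close>, the projection is \<open>- |v| sin (\<theta> - \<alpha>)\<close>, and \<open>\<alpha>\<close> can be dropped since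
  the law of a uniform angle is invariant under rotation. What remains is the law of \<open>|v| |sin \<theta>|\<close>.\<close>

theorem arcsine_law:
  fixes v :: "real^2"
  assumes v: "v \<noteq> 0"
  shows "distr angle_measure borel (\<lambda>\<theta>. \<bar>v \<bullet> nrm \<theta>\<bar>) = density lborel (arcsine_density (norm v))"
proof (rule measure_eqI)
  define r where "r = norm v"
  have r: "r > 0" using v by (simp add: r_def)
  have "v /\<^sub>R r \<in> sphere 0 1" using r by (simp add: r_def)
  then obtain \<alpha> where "v /\<^sub>R r = dir \<alpha>" using sphere_dir by blast
  hence "v = r *\<^sub>R dir \<alpha>" using r by (metis scaleR_scaleR right_inverse less_irrefl scaleR_one)
  hence "v \<bullet> nrm \<theta> = - r * sin (\<theta> + - \<alpha>)" for \<theta>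
    by (simp add: dir_def nrm_def inner_vec_def sum_2 sin_diff algebra_simps)
  hence vn: "\<bar>v \<bullet> nrm \<theta>\<bar> = r * \<bar>sin (\<theta> + - \<alpha>)\<bar>" for \<theta>
    using r by (simp add: abs_mult)
  fix A assume "A \<in> sets (distr angle_measure borel (\<lambda>\<theta>. \<bar>v \<bullet> nrm \<theta>\<bar>))"
  hence A [measurable]: "A \<in> sets borel" by simp
  define P where "P = {\<theta>. r * \<bar>sin \<theta>\<bar> \<in> A}"
  have P [measurable]: "P \<in> sets borel" unfolding P_def by measurable
  have vm: "(\<lambda>\<theta>. \<bar>v \<bullet> nrm \<theta>\<bar>) \<in> borel_measurable borel" by measurable
  have vP: "(\<lambda>\<theta>. \<bar>v \<bullet> nrm \<theta>\<bar>) -` A = {\<theta>. \<theta> + - \<alpha> \<in> P}"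
    unfolding vn P_def by auto
  have "emeasure (distr angle_measure borel (\<lambda>\<theta>. \<bar>v \<bullet> nrm \<theta>\<bar>)) A
      = emeasure angle_measure ((\<lambda>\<theta>. \<bar>v \<bullet> nrm \<theta>\<bar>) -` A \<inter> space angle_measure)"
    by (rule emeasure_distr) (use vm in simp_all)
  also have "\<dots> = emeasure angle_measure {\<theta>. \<theta> + - \<alpha> \<in> P}"
    by (simp only: vP space_uniform_measure space_lborel space_borel Int_UNIV_right)
  also have "\<dots> = emeasure angle_measure P"
  proof -
    have uniform: "emeasure angle_measure B = emeasure lborel ({0..2*pi} \<inter> B) / emeasure lborel {0..2*pi}"
      if "B \<in> sets borel" for B
      by (rule emeasure_uniform_measure) (use that in simp_all)
    have "{\<theta>. \<theta> + - \<alpha> \<in> P} \<in> sets borel"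
      using measurable_sets_borel[OF vm A] by (simp only: vP)
    moreover have "\<theta> + 2*pi \<in> P \<longleftrightarrow> \<theta> \<in> P" for \<theta> by (simp add: P_def)
    ultimately show ?thesis
      by (simp only: uniform P emeasure_periodic_shift[OF P])
  qed
  also have "\<dots> = (\<integral>\<^sup>+\<theta>. indicator A (r * \<bar>sin \<theta>\<bar>) * indicator {0..2*pi} \<theta> \<partial>lborel) / ennreal (2 * pi)"
  proof -
    have "emeasure angle_measure P = (\<integral>\<^sup>+\<theta>. indicator P \<theta> \<partial>angle_measure)" by simp
    also have "\<dots> = (\<integral>\<^sup>+\<theta>. indicator P \<theta> * indicator {0..2*pi} \<theta> \<partial>lborel) / ennreal (2 * pi)"
      by (subst nn_integral_uniform_measure) auto
    finally show ?thesis by (simp only: P_def indicator_def mem_Collect_eq)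
  qed
  also have "\<dots> = (4 * (\<integral>\<^sup>+\<theta>. indicator A (r * \<bar>sin \<theta>\<bar>) * indicator {0..pi/2} \<theta> \<partial>lborel)) / ennreal (2 * pi)"
    by (subst nn_integral_full_turn[of "\<lambda>x. indicator A (r * x)"]) auto
  also have "\<dots> = ennreal (2 / pi) * (\<integral>\<^sup>+\<theta>. indicator A (r * \<bar>sin \<theta>\<bar>) * indicator {0..pi/2} \<theta> \<partial>lborel)"
  proof -
    have "4 * X / ennreal (2 * pi) = ennreal (2 / pi) * X" for X
    proof -
      have "ennreal (2 / pi) = ennreal 4 / ennreal (2 * pi)"
        by (subst divide_ennreal) simp_all
      thus ?thesis by (simp only: divide_ennreal_def mult_ac ennreal_numeral)
    qed
    thus ?thesis .
  qed
  also have "\<dots> = (\<integral>\<^sup>+\<theta>. ennreal (2 / pi * indicator A (r * \<bar>sin \<theta>\<bar>)) * indicator {0..pi/2} \<theta> \<partial>lborel)"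
    by (subst nn_integral_cmult[symmetric]) (auto intro!: nn_integral_cong simp: indicator_def)
  also have "\<dots> = emeasure (density lborel (arcsine_density r)) A"
    by (subst nn_integral_sin_quarter[OF r A]) (simp add: emeasure_density)
  finally show "emeasure (distr angle_measure borel (\<lambda>\<theta>. \<bar>v \<bullet> nrm \<theta>\<bar>)) A
      = emeasure (density lborel (arcsine_density (norm v))) A" by (simp add: r_def)
qed simp

section \<open>The Abel integrals\<close>

text \<open>The fundamental theorem for an integrand that may be unbounded at both ends, as the Abel kernels are:
  nonnegativity makes integrability a consequence of the continuity of the primitive.\<close>

lemma FTC_nonneg_Ioo:
  fixes f F :: "real \<Rightarrow> real"
  assumes "a < b" and cont: "continuous_on {a..b} F"
    and deriv: "\<And>x. a < x \<Longrightarrow> x < b \<Longrightarrow> (F has_real_derivative f x) (at x)"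
    and f: "\<And>x. a < x \<Longrightarrow> x < b \<Longrightarrow> isCont f x"
    and nonneg: "\<And>x. a < x \<Longrightarrow> x < b \<Longrightarrow> 0 \<le> f x"
  shows "set_integrable lborel {a<..<b} f" and "(LINT x:{a<..<b}|lborel. f x) = F b - F a"
proof -
  have A: "((F \<circ> real_of_ereal) \<longlongrightarrow> F a) (at_right (ereal a))"
    unfolding ereal_tendsto_simps1
    using cont \<open>a < b\<close> by (simp add: continuous_on_Icc_at_rightD)
  have B: "((F \<circ> real_of_ereal) \<longlongrightarrow> F b) (at_left (ereal b))"
    unfolding ereal_tendsto_simps1
    using cont \<open>a < b\<close> by (simp add: continuous_on_Icc_at_leftD)
  have "set_integrable lborel (einterval (ereal a) (ereal b)) f"
    by (rule interval_integral_FTC_nonneg(1)[OF _ _ _ _ A B]) (use assms in auto)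
  thus "set_integrable lborel {a<..<b} f" by simp
  have "(LBINT x=ereal a..ereal b. f x) = F b - F a"
    by (rule interval_integral_FTC_nonneg(2)[OF _ _ _ _ A B]) (use assms in auto)
  thus "(LINT x:{a<..<b}|lborel. f x) = F b - F a"
    using \<open>a < b\<close> by (simp add: interval_lebesgue_integral_le_eq)
qed

lemma abel_kernel_integral:
  assumes r: "r > (0::real)"
  shows "set_integrable lborel {0<..<r} (\<lambda>s. (r\<^sup>2 - s\<^sup>2) powr (-1/2))"
    and "(LINT s:{0<..<r}|lborel. (r\<^sup>2 - s\<^sup>2) powr (-1/2)) = pi / 2"
proof -
  let ?F = "\<lambda>s. arcsin (s / r)"
  have pos: "r\<^sup>2 - s\<^sup>2 > 0" if "0 < s" "s < r" for s
    using that by (simp add: power_strict_mono)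
  have cont: "continuous_on {0..r} ?F"
    using r by (intro continuous_intros) (auto simp: divide_le_eq le_divide_eq)
  have deriv: "(?F has_real_derivative (r\<^sup>2 - s\<^sup>2) powr (-1/2)) (at s)" if s: "0 < s" "s < r" for s
  proof -
    have "(?F has_real_derivative inverse (sqrt (1 - (s / r)\<^sup>2)) * (1 / r)) (at s)"
      using s r by (auto intro!: derivative_eq_intros simp: less_divide_eq)
    also have "1 - (s / r)\<^sup>2 = (r\<^sup>2 - s\<^sup>2) / r\<^sup>2"
      using r by (simp add: power_divide diff_divide_distrib)
    also have "inverse (sqrt ((r\<^sup>2 - s\<^sup>2) / r\<^sup>2)) * (1 / r) = (r\<^sup>2 - s\<^sup>2) powr (-1/2)"
      unfolding powr_neg_half[OF pos[OF s]] using r by (simp add: real_sqrt_divide)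
    finally show ?thesis .
  qed
  have c: "isCont (\<lambda>s. (r\<^sup>2 - s\<^sup>2) powr (-1/2)) s" if "0 < s" "s < r" for s
    using pos[OF that] by (intro continuous_intros) auto
  note FTC = FTC_nonneg_Ioo[OF r cont deriv c]
  show "set_integrable lborel {0<..<r} (\<lambda>s. (r\<^sup>2 - s\<^sup>2) powr (-1/2))" by (rule FTC(1)) auto
  have "(LINT s:{0<..<r}|lborel. (r\<^sup>2 - s\<^sup>2) powr (-1/2)) = ?F r - ?F 0" by (rule FTC(2)) auto
  thus "(LINT s:{0<..<r}|lborel. (r\<^sup>2 - s\<^sup>2) powr (-1/2)) = pi / 2" using r by simp
qed

text \<open>In the variable \<open>s^2\<close> this is the integral of \<open>1 / (2 sqrt ((z - 1) (r^2 - z)))\<close> over \<open>1 < z < r^2\<close>,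
  hence independent of \<open>r\<close>. The affine map of \<open>(1, r^2)\<close> onto \<open>(-1, 1)\<close> gives the primitive as half
  an arcsine.\<close>

lemma beta_type_integral:
  assumes r: "r > (1::real)"
  shows "set_integrable lborel {1<..<r} (\<lambda>s. s / sqrt (s\<^sup>2 - 1) * (r\<^sup>2 - s\<^sup>2) powr (-1/2))"
    and "(LINT s:{1<..<r}|lborel. s / sqrt (s\<^sup>2 - 1) * (r\<^sup>2 - s\<^sup>2) powr (-1/2)) = pi / 2"
proof -
  define d where "d = r\<^sup>2 - 1"
  have d: "d > 0" using r by (simp add: d_def)
  let ?u = "\<lambda>s. (2 * s\<^sup>2 - 1 - r\<^sup>2) / d"
  let ?F = "\<lambda>s. arcsin (?u s) / 2"
  let ?f = "\<lambda>s. s / sqrt (s\<^sup>2 - 1) * (r\<^sup>2 - s\<^sup>2) powr (-1/2)"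
  have pos: "r\<^sup>2 - s\<^sup>2 > 0" "s\<^sup>2 - 1 > 0" if "1 < s" "s < r" for s
    using that by (simp_all add: power_strict_mono)
  have cont: "continuous_on {1..r} ?F"
  proof (intro continuous_intros ballI conjI)
    fix s assume "s \<in> {1..r}"
    hence "1 \<le> s\<^sup>2" "s\<^sup>2 \<le> r\<^sup>2" by (auto intro: power_mono)
    thus "-1 \<le> ?u s" "?u s \<le> 1"
      using d by (auto simp: pos_le_divide_eq pos_divide_le_eq d_def)
  qed (use d in auto)
  have deriv: "(?F has_real_derivative ?f s) (at s)" if s: "1 < s" "s < r" for s
  proof -
    have u: "1 + ?u s = 2 * (s\<^sup>2 - 1) / d" "1 - ?u s = 2 * (r\<^sup>2 - s\<^sup>2) / d"
      using d by (auto simp: field_simps d_def)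
    have "1 + ?u s > 0" "1 - ?u s > 0" unfolding u using d pos[OF s] by auto
    hence "-1 < ?u s" "?u s < 1" by linarith+
    hence "(?F has_real_derivative inverse (sqrt (1 - (?u s)\<^sup>2)) * (4 * s / d) / 2) (at s)"
      using d by (auto intro!: derivative_eq_intros)
    also have "1 - (?u s)\<^sup>2 = (1 + ?u s) * (1 - ?u s)" by (simp add: algebra_simps power2_eq_square)
    also have "\<dots> = (s\<^sup>2 - 1) * (r\<^sup>2 - s\<^sup>2) * (2 / d)\<^sup>2"
    proof -
      have "2 * A / d * (2 * B / d) = A * B * (2 / d)\<^sup>2" for A B
        by (simp add: power2_eq_square)
      thus ?thesis unfolding u .
    qed
    also have "inverse (sqrt ((s\<^sup>2 - 1) * (r\<^sup>2 - s\<^sup>2) * (2 / d)\<^sup>2)) * (4 * s / d) / 2 = ?f s"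
      unfolding powr_neg_half[OF pos(1)[OF s]] using d pos[OF s] by (simp add: real_sqrt_mult)
    finally show ?thesis .
  qed
  have c: "isCont ?f s" if "1 < s" "s < r" for s
    using pos[OF that] by (intro continuous_intros) auto
  note FTC = FTC_nonneg_Ioo[OF r cont deriv c]
  have nonneg: "0 \<le> ?f s" if "1 < s" "s < r" for s
    using that pos[OF that] by simp
  show "set_integrable lborel {1<..<r} ?f" by (rule FTC(1)) (use nonneg in auto)
  have "(LINT s:{1<..<r}|lborel. ?f s) = ?F r - ?F 1" by (rule FTC(2)) (use nonneg in auto)
  moreover have "?u r = 1" "?u 1 = - 1" using d by (auto simp: field_simps d_def)
  ultimately show "(LINT s:{1<..<r}|lborel. ?f s) = pi / 2" by simp
qed

text \<open>The wavelet of the theorem, extended by \<open>1\<close> to the negative half-line so that it is a Borel function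
  on all reals.\<close>

definition ball_wavelet :: "real \<Rightarrow> real"
  where "ball_wavelet r = (if r \<le> 1 then 1 else 1 - r / sqrt (r\<^sup>2 - 1))"

lemma borel_measurable_ball_wavelet [measurable]: "ball_wavelet \<in> borel_measurable borel"
  unfolding ball_wavelet_def by measurable

text \<open>This bound turns the mean of \<open>w\<close>, which is known, into a bound for the mean of \<open>|w|\<close>.\<close>

lemma abs_ball_wavelet_le: "\<bar>ball_wavelet r\<bar> \<le> 2 - ball_wavelet r"
proof -
  have "ball_wavelet r \<le> 1" by (simp add: ball_wavelet_def)
  thus ?thesis by linarith
qed

text \<open>For \<open>r > 1\<close> the two integrals of value \<open>\<pi> / 2\<close> computed above cancel.\<close>

lemma ball_wavelet_abel_integral:
  assumes r: "r > 0"
  shows "set_integrable lborel {0<..<r} (\<lambda>s. ball_wavelet s * (r\<^sup>2 - s\<^sup>2) powr (-1/2))" (is ?I)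
    and "(LINT s:{0<..<r}|lborel. ball_wavelet s * (r\<^sup>2 - s\<^sup>2) powr (-1/2))
      = (if r \<le> 1 then pi / 2 else 0)" (is ?E)
proof -
  let ?k = "\<lambda>s. (r\<^sup>2 - s\<^sup>2) powr (-1/2)"
  note k = abel_kernel_integral[OF r]
  have "?I \<and> ?E"
  proof (cases "r \<le> 1")
    case True
    have eq: "indicator {0<..<r} s *\<^sub>R (ball_wavelet s * ?k s) = indicator {0<..<r} s *\<^sub>R ?k s" for s
      using True by (auto simp: indicator_def ball_wavelet_def)
    show ?thesis using k True unfolding set_integrable_def set_lebesgue_integral_def eq by simp
  next
    case False
    hence r1: "r > 1" by simp
    note q = beta_type_integral[OF r1]
    have eq: "indicator {0<..<r} s *\<^sub>R (ball_wavelet s * ?k s)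
      = indicator {0<..<r} s *\<^sub>R ?k s - indicator {1<..<r} s *\<^sub>R (s / sqrt (s\<^sup>2 - 1) * ?k s)" for s
      using False by (auto simp: indicator_def ball_wavelet_def algebra_simps)
    show ?thesis
      using k q False unfolding set_integrable_def set_lebesgue_integral_def eq
      by (simp add: Bochner_Integration.integral_diff)
  qed
  thus ?I ?E by auto
qed

section \<open>The wavelet transform of a Radon transform\<close>

text \<open>By the arcsine law, the mean over all directions is the Abel integral at \<open>norm v\<close>.\<close>

lemma ball_wavelet_angular_mean:
  fixes v :: "real^2"
  assumes v: "v \<noteq> 0"
  shows "integrable angle_measure (\<lambda>\<theta>. ball_wavelet \<bar>v \<bullet> nrm \<theta>\<bar>)" (is ?I)
    and "(\<integral>\<theta>. ball_wavelet \<bar>v \<bullet> nrm \<theta>\<bar> \<partial>angle_measure) = (if norm v \<le> 1 then 1 else 0)" (is ?E)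
proof -
  let ?r = "norm v"
  have r: "?r > 0" using v by simp
  have m: "(\<lambda>\<theta>. \<bar>v \<bullet> nrm \<theta>\<bar>) \<in> angle_measure \<rightarrow>\<^sub>M borel" by measurable
  have eq: "arcsine_density ?r s *\<^sub>R ball_wavelet s
     = 2 / pi * (indicator {0<..<?r} s *\<^sub>R (ball_wavelet s * (?r\<^sup>2 - s\<^sup>2) powr (-1/2)))" for s
    by (simp add: arcsine_density_def)
  note abel = ball_wavelet_abel_integral[OF r, unfolded set_integrable_def set_lebesgue_integral_def]
  have "integrable lborel (\<lambda>s. arcsine_density ?r s *\<^sub>R ball_wavelet s)"
    unfolding eq using abel(1) by (rule integrable_mult_right)
  hence "integrable (distr angle_measure borel (\<lambda>\<theta>. \<bar>v \<bullet> nrm \<theta>\<bar>)) ball_wavelet"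
    unfolding arcsine_law[OF v] by (subst integrable_density) auto
  thus ?I by (rule integrable_distr[OF m])
  have "(\<integral>\<theta>. ball_wavelet \<bar>v \<bullet> nrm \<theta>\<bar> \<partial>angle_measure)
      = (\<integral>s. ball_wavelet s \<partial>distr angle_measure borel (\<lambda>\<theta>. \<bar>v \<bullet> nrm \<theta>\<bar>))"
    by (rule integral_distr[OF m, symmetric]) simp
  also have "\<dots> = (\<integral>s. arcsine_density ?r s *\<^sub>R ball_wavelet s \<partial>lborel)"
    unfolding arcsine_law[OF v] by (rule integral_density) auto
  also have "\<dots> = 2 / pi * (if ?r \<le> 1 then pi / 2 else 0)"
    unfolding eq by (simp only: integral_mult_right_zero abel(2))
  finally show ?E by simp
qed

lemma sphere_area_simps: "sphere_area 0 = 2" "sphere_area (Suc 0) = 2 * pi"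
  by (simp_all add: sphere_area_def powr_half_sqrt Gamma_one_half_real)

lemma integrable_continuous_compact_support:
  fixes f :: "'a::euclidean_space \<Rightarrow> 'b::{banach,second_countable_topology}"
  assumes "continuous_on UNIV f" and "compact (closure {x. f x \<noteq> 0})"
  shows "integrable lborel f"
proof -
  have "integrable lborel (\<lambda>x. indicator (closure {x. f x \<noteq> 0}) x *\<^sub>R f x)"
    using assms by (intro borel_integrable_compact) (auto intro: continuous_on_subset)
  also have "(\<lambda>x. indicator (closure {x. f x \<noteq> 0}) x *\<^sub>R f x) = f"
    using closure_subset[of "{x. f x \<noteq> 0}"] by (auto simp: fun_eq_iff indicator_def)
  finally show ?thesis .
qed

text \<open>The mean over the lines through \<open>y\<close> is the indicator of \<open>|x - y| \<le> a\<close>, except perhaps at the single point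
  \<open>y = x\<close>, where the arcsine law degenerates.\<close>

lemma wavelet_transform_radon:
  fixes f :: "real^2 \<Rightarrow> 'b::{banach,second_countable_topology}"
  assumes a: "a > 0" and f: "integrable lborel f"
  shows "integrable A21_measure (wavelet_integrand ball_wavelet a (radon f) x)" (is ?I)
    and "wavelet_transform ball_wavelet a (radon f) x = (LINT y:ball 0 1|lborel. f (x - a *\<^sub>R y))" (is ?E)
proof -
  interpret angle: prob_space angle_measure by (rule prob_space_angle)
  interpret AP: pair_sigma_finite angle_measure "lborel :: (real^2) measure" ..
  interpret PA: pair_sigma_finite "lborel :: (real^2) measure" angle_measure ..
  have fm [measurable]: "f \<in> borel_measurable borel"
    using f by (simp add: borel_measurable_integrable)
  let ?\<phi> = "\<lambda>\<tau>. ball_wavelet (infdist x (line_of \<tau>) / a)"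
  let ?v = "\<lambda>y. (x - y) /\<^sub>R a"
  let ?g = "\<lambda>y \<theta>. ball_wavelet \<bar>?v y \<bullet> nrm \<theta>\<bar>"
  have [measurable]: "cball (0::real^2) 1 \<in> sets borel" "ball (0::real^2) 1 \<in> sets borel" by simp_all
  have \<phi>: "?\<phi> \<in> borel_measurable A21_sigma"
    using borel_measurable_infdist_line by measurable
  have \<phi>_line: "?\<phi> (line_through \<theta> y) = ?g y \<theta>" for \<theta> y
    using a by (simp add: infdist_line_through abs_mult divide_inverse mult.commute)
  have cancel: "(a *\<^sub>R y) /\<^sub>R a = y" for y :: "real^2" using a by simp
  have v: "?v y \<noteq> 0" if "y \<noteq> x" for y using that a by simp
  have gm: "(\<lambda>p. ?g (fst p) (snd p)) \<in> borel_measurable (lborel \<Otimes>\<^sub>M angle_measure)"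
    by measurable
  \<comment> \<open>This bound makes the double integral over points and directions converge absolutely.\<close>
  have mean_abs: "(\<integral>\<theta>. \<bar>?g y \<theta>\<bar> \<partial>angle_measure) \<le> 2" if "y \<noteq> x" for y
  proof -
    note g = ball_wavelet_angular_mean[OF v[OF that]]
    have "(\<integral>\<theta>. \<bar>?g y \<theta>\<bar> \<partial>angle_measure) \<le> (\<integral>\<theta>. 2 - ?g y \<theta> \<partial>angle_measure)"
      using g(1) by (intro integral_mono) (auto intro: abs_ball_wavelet_le)
    also have "\<dots> = 2 - (if norm (?v y) \<le> 1 then 1 else 0)"
      using g by (simp add: angle.prob_space)
    finally show ?thesis by (auto split: if_splits)
  qed
  have "integrable (lborel \<Otimes>\<^sub>M angle_measure) (\<lambda>p. ?g (fst p) (snd p) *\<^sub>R f (fst p))"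
  proof (rule PA.Fubini_integrable)
    show "(\<lambda>p. ?g (fst p) (snd p) *\<^sub>R f (fst p)) \<in> borel_measurable (lborel \<Otimes>\<^sub>M angle_measure)"
      using gm by measurable
    show "AE y in lborel. integrable angle_measure (\<lambda>\<theta>. ?g (fst (y, \<theta>)) (snd (y, \<theta>)) *\<^sub>R f (fst (y, \<theta>)))"
      using AE_lborel_singleton[of x]
    proof eventually_elim
      case (elim y)
      from ball_wavelet_angular_mean(1)[OF v[OF elim]]
      show ?case unfolding fst_conv snd_conv by (rule integrable_scaleR_left)
    qed
    show "integrable lborel (\<lambda>y. \<integral>\<theta>. norm (?g (fst (y, \<theta>)) (snd (y, \<theta>)) *\<^sub>R f (fst (y, \<theta>))) \<partial>angle_measure)"
    proof (rule Bochner_Integration.integrable_bound)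
      show "integrable lborel (\<lambda>y. 2 * norm (f y))" using f by auto
      show "(\<lambda>y. \<integral>\<theta>. norm (?g (fst (y, \<theta>)) (snd (y, \<theta>)) *\<^sub>R f (fst (y, \<theta>))) \<partial>angle_measure)
          \<in> borel_measurable lborel"
        by measurable
      show "AE y in lborel. norm (\<integral>\<theta>. norm (?g (fst (y, \<theta>)) (snd (y, \<theta>)) *\<^sub>R f (fst (y, \<theta>))) \<partial>angle_measure)
          \<le> norm (2 * norm (f y))"
        using AE_lborel_singleton[of x]
      proof eventually_elim
        case (elim y)
        have "(\<integral>\<theta>. \<bar>?g y \<theta>\<bar> * norm (f y) \<partial>angle_measure) \<le> 2 * norm (f y)"
          using mean_abs[OF elim] by (simp add: mult_right_mono)
        moreover have "0 \<le> (\<integral>\<theta>. \<bar>?g y \<theta>\<bar> * norm (f y) \<partial>angle_measure)"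
          by (rule integral_nonneg_AE) simp
        ultimately show ?case by simp
      qed
    qed
  qed
  from PA.integrable_product_swap[OF this]
  have int: "integrable (angle_measure \<Otimes>\<^sub>M lborel) (\<lambda>p. ?\<phi> (line_through (fst p) (snd p)) *\<^sub>R f (snd p))"
    by (simp add: \<phi>_line case_prod_beta')
  note dual = radon_duality[OF fm \<phi> int]
  show ?I using dual(1) by (simp add: wavelet_integrand_def[abs_def])
  have "wavelet_transform ball_wavelet a (radon f) x
      = (1 / a\<^sup>2) *\<^sub>R (\<integral>y. (\<integral>\<theta>. ?g y \<theta> *\<^sub>R f y \<partial>angle_measure) \<partial>lborel)"
    using dual(2) by (simp add: wavelet_transform_def wavelet_integrand_def[abs_def] \<phi>_line)
  also have "(\<integral>y. (\<integral>\<theta>. ?g y \<theta> *\<^sub>R f y \<partial>angle_measure) \<partial>lborel)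
      = (\<integral>y. indicator (cball 0 1) (?v y) *\<^sub>R f y \<partial>lborel)"
  proof (rule integral_cong_AE)
    show "AE y in lborel. (\<integral>\<theta>. ?g y \<theta> *\<^sub>R f y \<partial>angle_measure) = indicator (cball 0 1) (?v y) *\<^sub>R f y"
      using AE_lborel_singleton[of x]
    proof eventually_elim
      case (elim y)
      note g = ball_wavelet_angular_mean[OF v[OF elim]]
      have "(\<integral>\<theta>. ?g y \<theta> *\<^sub>R f y \<partial>angle_measure) = (\<integral>\<theta>. ?g y \<theta> \<partial>angle_measure) *\<^sub>R f y"
        using g(1) by (intro integral_scaleR_left)
      also have "(\<integral>\<theta>. ?g y \<theta> \<partial>angle_measure) = indicator (cball 0 1) (?v y)"
        unfolding g(2) by (simp add: indicator_def)
      finally show ?case .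
    qed
  qed (use fm in simp_all)
  also have "\<dots> = a\<^sup>2 *\<^sub>R (\<integral>y. indicator (cball 0 1) y *\<^sub>R f (x - a *\<^sub>R y) \<partial>lborel)"
    using a by (subst lborel_affine[of "- a" x])
      (simp_all add: integral_density integral_distr cancel del: scaleR_scaleR)
  also have "(\<integral>y. indicator (cball 0 1) y *\<^sub>R f (x - a *\<^sub>R y) \<partial>lborel) = (LINT y:ball 0 1|lborel. f (x - a *\<^sub>R y))"
    unfolding set_lebesgue_integral_def
  proof (rule integral_cong_AE)
    have "sphere (0::real^2) 1 \<in> null_sets lborel"
      using negligible_sphere[of "0::real^2" 1] by (simp add: null_sets_def negligible_iff_null_sets null_sets_completion_iff)
    from AE_not_in[OF this]
    show "AE y in lborel. indicator (cball 0 1) y *\<^sub>R f (x - a *\<^sub>R y) = indicator (ball 0 1) y *\<^sub>R f (x - a *\<^sub>R y)"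
      by eventually_elim (auto simp: indicator_def)
  qed (use fm in simp_all)
  finally show ?E using a by simp
qed

text \<open>Only the values of \<open>w\<close> on the nonnegative half-line enter, and there \<open>w\<close> is \<open>ball_wavelet\<close>.\<close>

theorem theorem1p3:
  fixes k n :: nat and \<psi> w :: "real \<Rightarrow> real"
  assumes "k = 1" and "n = 2"
    and "\<And>r. 0 \<le> r \<Longrightarrow> r \<le> 1 \<Longrightarrow> \<psi> r = 1"
    and "\<And>r. r > 1 \<Longrightarrow> \<psi> r = 0"
    and "\<And>r. 0 \<le> r \<Longrightarrow> r \<le> 1 \<Longrightarrow> w r = 1"
    and "\<And>r. r > 1 \<Longrightarrow> w r = 1 - r / sqrt (r\<^sup>2 - 1)"
  shows "solves_abel_equation k n w \<psi> \<and>
    (\<forall>r>0. 2 / pi * (LINT s:{0<..<r}|lborel. w s * (r\<^sup>2 - s\<^sup>2) powr (- 1 / 2)) = \<psi> r) \<and>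
    (\<forall>f :: real^2 \<Rightarrow> complex. continuous_on UNIV f \<longrightarrow> compact (closure {x. f x \<noteq> 0}) \<longrightarrow>
      (\<forall>a>0. \<forall>x. integrable A21_measure (wavelet_integrand w a (radon f) x) \<and>
        wavelet_transform w a (radon f) x = (LINT y:ball 0 1|lborel. f (x - a *\<^sub>R y))))"
proof (intro conjI allI impI)
  have w: "w s = ball_wavelet s" if "s \<ge> 0" for s
    using assms(5,6) that by (simp add: ball_wavelet_def)
  have ind: "indicator {0<..<r} s *\<^sub>R (w s * z) = indicator {0<..<r} s *\<^sub>R (ball_wavelet s * z)" for r s z :: real
    by (simp add: indicator_def w)
  have int: "set_integrable lborel {0<..<r} (\<lambda>s. w s * (r\<^sup>2 - s\<^sup>2) powr (-1/2))" if "r > 0" for r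
    using ball_wavelet_abel_integral(1)[OF that] by (simp only: set_integrable_def ind)
  have abel: "2 / pi * (LINT s:{0<..<r}|lborel. w s * (r\<^sup>2 - s\<^sup>2) powr (-1/2)) = \<psi> r" if "r > 0" for r
    using ball_wavelet_abel_integral(2)[OF that] that assms(3,4)
    by (simp only: set_lebesgue_integral_def ind) simp
  show "2 / pi * (LINT s:{0<..<r}|lborel. w s * (r\<^sup>2 - s\<^sup>2) powr (- 1 / 2)) = \<psi> r" if "0 < r" for r
    by (rule abel[OF that])
  have integrand: "abel_integrand k n w r = (\<lambda>s. w s * (r\<^sup>2 - s\<^sup>2) powr (-1/2))" for r
    by (simp add: abel_integrand_def fun_eq_iff assms(1,2))
  have const: "sphere_area (k - 1) * sphere_area (n - k - 1) / sphere_area (n - 1) * r powr (2 - real n) = 2 / pi"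
    if "r > 0" for r
    using that by (simp add: assms(1,2) sphere_area_simps)
  show "solves_abel_equation k n w \<psi>"
    unfolding solves_abel_equation_def integrand using int abel const by (metis (no_types, lifting))
  have integrand_w: "wavelet_integrand w a \<phi> x = wavelet_integrand ball_wavelet a \<phi> x"
    if "a > 0" for a x and \<phi> :: "_ \<Rightarrow> complex"
    using that by (simp add: wavelet_integrand_def fun_eq_iff w infdist_nonneg)
  fix f :: "real^2 \<Rightarrow> complex" and a :: real and x
  assume f: "continuous_on UNIV f" "compact (closure {x. f x \<noteq> 0})" and a: "0 < a"
  note fint = integrable_continuous_compact_support[OF f]
  show "integrable A21_measure (wavelet_integrand w a (radon f) x)"
    unfolding integrand_w[OF a] by (rule wavelet_transform_radon(1)[OF a fint])
  show "wavelet_transform w a (radon f) x = (LINT y:ball 0 1|lborel. f (x - a *\<^sub>R y))"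
    using wavelet_transform_radon(2)[OF a fint, of x] by (simp only: wavelet_transform_def integrand_w[OF a])
qed

end
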